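(* Let $A$ be a coefficient matrix satisfying the ellipticity condition with constant $\mu$ and $\Omega$ a bounded Lipschitz domain. Let $u\in H^1_0(\Omega;\mathbb{R}^m)$ be a weak solution of $-\mathrm{div}(A\nabla u)=\mathrm{div}(f)$ in $\Omega$, where $f\in L^2(\Omega;\mathbb{R}^{m\times d})$. Then there exists $\kappa\in(0,1/2)$, depending only on $d,m,\mu$ and the Lipschitz character of $\Omega$, such that for $|\sigma|\le2\kappa$, $$\int_\Omega|\nabla u|^2[\mathrm{dist}(x,\partial\Omega)]^\sigma dx\le C\int_\Omega|f|^2[\mathrm{dist}(x,\partial\Omega)]^\sigma dx,$$ where $C>0$ depends only on $d,m,\mu$ and the Lipschitz character of $\Omega$.
   Context: $A=(a^{\alpha\beta}_{ij}(x))$, $1\le i,j\le d$, $1\le\alpha,\beta\le m$, real measurable with $\mu|\xi|^2\le a^{\alpha\beta}_{ij}(x)\xi^\alpha_i\xi^\beta_j$ and $\|A\|_\infty\le\mu^{-1}$ for a.e. $x$, all $\xi\in\mathbb{R}^{m\times d}$. $\mathrm{div}(A\nabla u)$ has components $\partial_i(a^{\alpha\beta}_{ij}\partial_ju^\beta)$; $\mathrm{div}(f)$ has components $\partial_if^\alpha_i$. *)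

theory Defs
  imports "HOL-Analysis.Analysis"
begin

definition partial :: "'d::finite \<Rightarrow> (real^'d \<Rightarrow> real) \<Rightarrow> real^'d \<Rightarrow> real" where
  "partial i f x = frechet_derivative f (at x) (axis i 1)"

fun Ck :: "nat \<Rightarrow> (real^'d::finite \<Rightarrow> real) \<Rightarrow> bool" where
  "Ck 0 f = continuous_on UNIV f"
| "Ck (Suc k) f = (continuous_on UNIV f \<and> (\<forall>x. f differentiable (at x)) \<and> (\<forall>i. Ck k (partial i f)))"

definition test_fn :: "(real^'d::finite) set \<Rightarrow> (real^'d \<Rightarrow> real) \<Rightarrow> bool" where
  "test_fn U \<phi> \<longleftrightarrow> (\<forall>k. Ck k \<phi>) \<and> compact (closure {x. \<phi> x \<noteq> 0}) \<and> closure {x. \<phi> x \<noteq> 0} \<subseteq> U"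

definition vtest_fn :: "(real^'d::finite) set \<Rightarrow> (real^'d \<Rightarrow> real^'m::finite) \<Rightarrow> bool" where
  "vtest_fn U \<phi> \<longleftrightarrow> (\<forall>\<alpha>. test_fn U (\<lambda>x. \<phi> x $ \<alpha>))"

definition cgrad :: "(real^'d::finite \<Rightarrow> real^'m::finite) \<Rightarrow> real^'d \<Rightarrow> real^'d^'m" where
  "cgrad \<phi> x = (\<chi> \<alpha> i. partial i (\<lambda>y. \<phi> y $ \<alpha>) x)"

definition L2 :: "(real^'d::finite) set \<Rightarrow> (real^'d \<Rightarrow> 'b::euclidean_space) \<Rightarrow> bool" where
  "L2 U g \<longleftrightarrow> set_borel_measurable lebesgue U g \<and> set_integrable lebesgue U (\<lambda>x. (norm (g x))\<^sup>2)"

definition weak_grad :: "(real^'d::finite) set \<Rightarrow> (real^'d \<Rightarrow> real^'m::finite) \<Rightarrow> (real^'d \<Rightarrow> real^'d^'m) \<Rightarrow> bool" where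
  "weak_grad U u Du \<longleftrightarrow>
     (\<forall>K. compact K \<and> K \<subseteq> U \<longrightarrow> set_integrable lebesgue K u \<and> set_integrable lebesgue K Du) \<and>
     (\<forall>\<phi> \<alpha> i. test_fn U \<phi> \<longrightarrow>
        (LINT x:U|lebesgue. u x $ \<alpha> * partial i \<phi> x) = - (LINT x:U|lebesgue. Du x $ \<alpha> $ i * \<phi> x))"

definition H1 :: "(real^'d::finite) set \<Rightarrow> (real^'d \<Rightarrow> real^'m::finite) \<Rightarrow> (real^'d \<Rightarrow> real^'d^'m) \<Rightarrow> bool" where
  "H1 U u Du \<longleftrightarrow> weak_grad U u Du \<and> L2 U u \<and> L2 U Du"

definition H10 :: "(real^'d::finite) set \<Rightarrow> (real^'d \<Rightarrow> real^'m::finite) \<Rightarrow> (real^'d \<Rightarrow> real^'d^'m) \<Rightarrow> bool" where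
  "H10 U u Du \<longleftrightarrow> H1 U u Du \<and>
     (\<exists>\<phi> :: nat \<Rightarrow> real^'d \<Rightarrow> real^'m. (\<forall>k. vtest_fn U (\<phi> k)) \<and>
        (\<lambda>k. LINT x:U|lebesgue. (norm (u x - \<phi> k x))\<^sup>2 + (norm (Du x - cgrad (\<phi> k) x))\<^sup>2) \<longlonglongrightarrow> 0)"

definition elliptic :: "real \<Rightarrow> (real^'d::finite \<Rightarrow> 'm::finite \<Rightarrow> 'm \<Rightarrow> 'd \<Rightarrow> 'd \<Rightarrow> real) \<Rightarrow> bool" where
  "elliptic \<mu> A \<longleftrightarrow> (\<forall>\<alpha> \<beta> i j. (\<lambda>x. A x \<alpha> \<beta> i j) \<in> borel_measurable lebesgue) \<and>
     (AE x in lebesgue. \<forall>\<xi> :: real^'d^'m.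
        \<mu> * (norm \<xi>)\<^sup>2 \<le> (\<Sum>\<alpha>\<in>UNIV. \<Sum>\<beta>\<in>UNIV. \<Sum>i\<in>UNIV. \<Sum>j\<in>UNIV. A x \<alpha> \<beta> i j * \<xi> $ \<alpha> $ i * \<xi> $ \<beta> $ j) \<and>
        norm (\<chi> \<alpha> i. \<Sum>\<beta>\<in>UNIV. \<Sum>j\<in>UNIV. A x \<alpha> \<beta> i j * \<xi> $ \<beta> $ j) \<le> norm \<xi> / \<mu>)"

text \<open>u (in H^1_0 with weak gradient Du) is a weak solution of -div(A grad u) = div f in U.\<close>
definition weak_solution :: "(real^'d::finite) set \<Rightarrow> (real^'d \<Rightarrow> 'm::finite \<Rightarrow> 'm \<Rightarrow> 'd \<Rightarrow> 'd \<Rightarrow> real)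
    \<Rightarrow> (real^'d \<Rightarrow> real^'d^'m) \<Rightarrow> (real^'d \<Rightarrow> real^'d^'m) \<Rightarrow> bool" where
  "weak_solution U A Du f \<longleftrightarrow> (\<forall>\<phi> :: real^'d \<Rightarrow> real^'m. vtest_fn U \<phi> \<longrightarrow>
     (LINT x:U|lebesgue. \<Sum>\<alpha>\<in>UNIV. \<Sum>\<beta>\<in>UNIV. \<Sum>i\<in>UNIV. \<Sum>j\<in>UNIV. A x \<alpha> \<beta> i j * Du x $ \<beta> $ j * cgrad \<phi> x $ \<alpha> $ i)
     = - (LINT x:U|lebesgue. \<Sum>\<alpha>\<in>UNIV. \<Sum>i\<in>UNIV. f x $ \<alpha> $ i * cgrad \<phi> x $ \<alpha> $ i))"

definition hproj :: "real^'d::finite \<Rightarrow> real^'d \<Rightarrow> real^'d" where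
  "hproj \<nu> y = y - (y \<bullet> \<nu>) *\<^sub>R \<nu>"

definition cyl :: "real^'d::finite \<Rightarrow> real^'d \<Rightarrow> real \<Rightarrow> real \<Rightarrow> (real^'d) set" where
  "cyl z \<nu> r h = {x. norm (hproj \<nu> (x - z)) < r \<and> \<bar>(x - z) \<bullet> \<nu>\<bar> < h}"

text \<open>Bounded Lipschitz domain with Lipschitz character (M, N): there is r0 > 0 and N coordinate
  cylinders centered on the boundary in which Omega is the region above the graph of an
  M-Lipschitz function, and the concentric half-size cylinders cover the boundary.\<close>
definition lipschitz_domain_char :: "(real^'d::finite) set \<Rightarrow> real \<Rightarrow> nat \<Rightarrow> bool" where
  "lipschitz_domain_char \<Omega> M N \<longleftrightarrow> bounded \<Omega> \<and> open \<Omega> \<and> connected \<Omega> \<and> \<Omega> \<noteq> {} \<and>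
     (\<exists>r0 > 0. \<exists>(z :: nat \<Rightarrow> real^'d) (\<nu> :: nat \<Rightarrow> real^'d) (\<psi> :: nat \<Rightarrow> real^'d \<Rightarrow> real).
        (\<forall>l<N. z l \<in> frontier \<Omega> \<and> norm (\<nu> l) = 1 \<and>
           M-lipschitz_on {y. y \<bullet> \<nu> l = 0} (\<psi> l) \<and> \<psi> l 0 = 0 \<and>
           \<Omega> \<inter> cyl (z l) (\<nu> l) r0 (10 * (M + 1) * r0) =
             {x \<in> cyl (z l) (\<nu> l) r0 (10 * (M + 1) * r0). (x - z l) \<bullet> \<nu> l > \<psi> l (hproj (\<nu> l) (x - z l))}) \<and>
        frontier \<Omega> \<subseteq> (\<Union>l<N. cyl (z l) (\<nu> l) (r0 / 2) (5 * (M + 1) * r0)))"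

end

theory Submission
  imports Defs
begin

text \<open>
  Test the equation with \<open>w\<^sup>2 \<phi>\<close>, where \<open>\<phi>\<close> is a smooth compactly supported approximation of \<open>u\<close> and
  \<open>w = \<eta> powr (\<sigma> / 2)\<close> for a smooth 1-Lipschitz majorant \<open>\<eta>\<close> of the distance \<open>\<rho>\<close> to the boundary. The
  terms containing \<open>\<nabla>w\<close> are bounded by \<open>\<bar>\<sigma>\<bar> w \<bar>\<phi>\<bar> / \<rho>\<close>, and Hardy's inequality applied to \<open>w \<phi>\<close>
  absorbs them for small \<open>\<sigma>\<close>. Taking \<open>\<eta>\<close> to be a soft minimum of distances to a finite net of the
  boundary avoids mollification.

  Hardy's inequality reduces to the one-dimensional one: near the boundary along the graph direction
  of a coordinate cylinder, away from it by a Poincare inequality, whose constant is controlled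
  because the boundary, and hence the connected domain, has small width. In dimension one the
  boundary pieces can be far apart, but there the domain is an interval.
\<close>

subsection \<open>Calculus of smooth functions\<close>

text \<open>The weak formulation is available only for smooth compactly supported test fields.
  Building the test field from the approximation instead of from \<open>u\<close> avoids extending
  the formulation by density; the price is one error term in \<open>Du - cgrad \<phi>\<close>, which
  vanishes in the limit because \<open>w\<close> is bounded on the bounded domain. For a fixed
  majorant \<open>\<eta>\<close> all integrals in the energy estimate are finite, which absorbing a
  term into the left side requires. With the true weight and negative \<open>\<sigma>\<close> they
  may be infinite, so the final estimate uses nonnegative integrals and \<open>\<eta>\<close> is
  sent to the distance only at the end. That \<open>\<eta>\<close> is 1-Lipschitz and lies above the
  distance gives |grad w| dist <= (|sigma| / 2) w. The size \<open>r0\<close> of the coordinate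
  cylinders must not enter any constant. It cancels because \<open>N\<close> cylinders bound the
  width of the domain by a multiple of \<open>r0\<close>, while points that the cylinders miss keep
  a distance of at least \<open>r0 / 4\<close> from the frontier.\<close>

definition smooth :: "(real^'d::finite \<Rightarrow> real) \<Rightarrow> bool" where
  "smooth f \<longleftrightarrow> (\<forall>k. Ck k f)"

definition gradient :: "(real^'d::finite \<Rightarrow> real) \<Rightarrow> real^'d \<Rightarrow> real^'d" where
  "gradient f x = (\<chi> i. partial i f x)"

lemma partial_eqI:
  assumes "(f has_derivative D) (at x)"
  shows "partial i f x = D (axis i 1)"
  using assms by (simp add: partial_def frechet_derivative_at[symmetric])

lemma has_derivative_gradient:
  assumes "f differentiable at x"
  shows "(f has_derivative (\<lambda>v. gradient f x \<bullet> v)) (at x)"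
proof -
  have D: "(f has_derivative frechet_derivative f (at x)) (at x)"
    using assms by (simp add: frechet_derivative_works)
  interpret bounded_linear "frechet_derivative f (at x)"
    using D by (rule has_derivative_bounded_linear)
  have "frechet_derivative f (at x) v = gradient f x \<bullet> v" for v
  proof -
    have "frechet_derivative f (at x) v = frechet_derivative f (at x) (\<Sum>i\<in>UNIV. (v $ i) *\<^sub>R axis i 1)"
      by (simp add: basis_expansion flip: scalar_mult_eq_scaleR)
    also have "\<dots> = (\<Sum>i\<in>UNIV. v $ i * partial i f x)"
      by (simp add: sum scaleR partial_def)
    finally show ?thesis
      by (simp add: gradient_def inner_vec_def mult.commute)
  qed
  then have "frechet_derivative f (at x) = (\<lambda>v. gradient f x \<bullet> v)" by (rule ext)
  then show ?thesis using D by simp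
qed

lemma Ck_SucD: "Ck (Suc k) f \<Longrightarrow> Ck k f"
proof (induction k arbitrary: f)
  case (Suc k)
  from Suc.prems have "continuous_on UNIV f" "\<forall>x. f differentiable (at x)" "\<And>i. Ck (Suc k) (partial i f)"
    by simp_all
  with Suc.IH show ?case unfolding Ck.simps by blast
qed simp

lemma Ck_const: "Ck k (\<lambda>_::real^'d::finite. c)"
proof (induction k arbitrary: c)
  case (Suc k)
  have "partial i (\<lambda>_. c) = (\<lambda>_. 0)" for i :: 'd
    by (intro ext, subst partial_eqI[OF has_derivative_const]) simp
  then show ?case using Suc by simp
qed simp

lemma partial_nth: "partial i (\<lambda>x. x $ j) = (\<lambda>_. axis i 1 $ j)"
  by (intro ext partial_eqI bounded_linear.has_derivative[OF bounded_linear_vec_nth has_derivative_ident])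

lemma Ck_nth: "Ck k (\<lambda>x::real^'d::finite. x $ j)"
proof (cases k)
  case (Suc k)
  have "(\<lambda>x::real^'d. x $ j) differentiable at x" for x
    unfolding differentiable_def by (rule exI, rule bounded_linear.has_derivative[OF bounded_linear_vec_nth has_derivative_ident])
  then show ?thesis unfolding Suc
    by (auto simp: partial_nth Ck_const intro!: continuous_intros)
qed (auto intro!: continuous_intros)

lemma partial_add:
  assumes "f differentiable at x" "g differentiable at x"
  shows "partial i (\<lambda>x. f x + g x) x = partial i f x + partial i g x"
  using has_derivative_add[OF has_derivative_gradient[OF assms(1)] has_derivative_gradient[OF assms(2)]]
  by (subst partial_eqI, assumption) (simp add: gradient_def inner_axis)

lemma partial_mult:
  assumes "f differentiable at x" "g differentiable at x"
  shows "partial i (\<lambda>x. f x * g x) x = f x * partial i g x + partial i f x * g x"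
  using has_derivative_mult[OF has_derivative_gradient[OF assms(1)] has_derivative_gradient[OF assms(2)]]
  by (subst partial_eqI, assumption) (simp add: gradient_def inner_axis)

lemma Ck_add: "Ck k f \<Longrightarrow> Ck k g \<Longrightarrow> Ck k (\<lambda>x. f x + g x)"
proof (induction k arbitrary: f g)
  case (Suc k)
  then have "partial i (\<lambda>x. f x + g x) = (\<lambda>x. partial i f x + partial i g x)" for i
    by (intro ext partial_add) auto
  then show ?case using Suc by (auto intro!: continuous_intros)
qed (auto intro!: continuous_intros)

lemma Ck_mult: "Ck k f \<Longrightarrow> Ck k g \<Longrightarrow> Ck k (\<lambda>x. f x * g x)"
proof (induction k arbitrary: f g)
  case (Suc k)
  then have "partial i (\<lambda>x. f x * g x) = (\<lambda>x. f x * partial i g x + partial i f x * g x)" for i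
    by (intro ext partial_mult) auto
  moreover have "Ck k (\<lambda>x. f x * partial i g x + partial i f x * g x)" for i
    using Suc.prems Suc.prems[THEN Ck_SucD] by (intro Ck_add Suc.IH) auto
  ultimately show ?case using Suc.prems by (auto intro!: continuous_intros)
qed (auto intro!: continuous_intros)

lemma partial_compose:
  assumes "(G has_real_derivative G') (at (f x))" "f differentiable at x"
  shows "partial i (\<lambda>x. G (f x)) x = G' * partial i f x"
proof -
  have "((\<lambda>x. G (f x)) has_derivative (\<lambda>v. G' * (gradient f x \<bullet> v))) (at x)"
    using has_derivative_compose[OF has_derivative_gradient[OF assms(2)], of G "(*) G'"] assms(1)
    by (simp add: has_field_derivative_def)
  from partial_eqI[OF this] show ?thesis by (simp add: gradient_def inner_axis)
qed

text \<open>\<open>G\<close> is a tower of successive derivatives: differentiating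
  \<open>G n\<close> after \<open>f\<close> produces \<open>G (Suc n)\<close> after \<open>f\<close>
  times a partial derivative of \<open>f\<close>, so the induction on \<open>k\<close> closes once
  \<open>n\<close> is arbitrary. The tower is needed only at the values of \<open>f\<close>, which
  admits \<open>ln\<close> and \<open>powr\<close> for positive \<open>f\<close>.\<close>

lemma Ck_compose:
  fixes G :: "nat \<Rightarrow> real \<Rightarrow> real"
  assumes G: "\<And>n x. (G n has_real_derivative G (Suc n) (f x)) (at (f x))"
  shows "Ck k f \<Longrightarrow> Ck k (\<lambda>x. G n (f x))"
proof (induction k arbitrary: n)
  case 0
  then have "isCont f x" for x by (simp add: continuous_on_eq_continuous_at)
  then have "isCont (\<lambda>x. G n (f x)) x" for x
    by (rule isCont_o2) (rule DERIV_isCont[OF G])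
  then show ?case by (simp add: continuous_on_eq_continuous_at)
next
  case (Suc k)
  have fd: "f differentiable at x" for x using Suc.prems by simp
  have d: "(\<lambda>x. G n (f x)) differentiable at x" for x
    using has_derivative_compose[OF has_derivative_gradient[OF fd], of "G n"] G[of n x]
    unfolding has_field_derivative_def differentiable_def by blast
  moreover have "partial i (\<lambda>x. G n (f x)) = (\<lambda>x. G (Suc n) (f x) * partial i f x)" for i
    by (intro ext partial_compose G fd)
  moreover have "Ck k (\<lambda>x. G (Suc n) (f x) * partial i f x)" for i
    using Suc.prems Ck_SucD[OF Suc.prems] by (intro Ck_mult Suc.IH) auto
  moreover have "continuous_on UNIV (\<lambda>x. G n (f x))"
    using d by (intro differentiable_imp_continuous_on) (simp add: differentiable_on_def)
  ultimately show ?case using d by simp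
qed

lemma smooth_const: "smooth (\<lambda>_. c)"
  and smooth_nth: "smooth (\<lambda>x. x $ i)"
  and smooth_add: "smooth f \<Longrightarrow> smooth g \<Longrightarrow> smooth (\<lambda>x. f x + g x)"
  and smooth_mult: "smooth f \<Longrightarrow> smooth g \<Longrightarrow> smooth (\<lambda>x. f x * g x)"
  by (simp_all add: smooth_def Ck_const Ck_nth Ck_add Ck_mult)

lemma smooth_sum:
  "(\<And>j. j \<in> J \<Longrightarrow> smooth (f j)) \<Longrightarrow> smooth (\<lambda>x. \<Sum>j\<in>J. f j x)"
  by (induction J rule: infinite_finite_induct) (auto intro: smooth_const smooth_add)

lemma smooth_differentiable: "smooth f \<Longrightarrow> f differentiable at x"
  using Ck.simps(2)[of 0 f] by (simp add: smooth_def)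

lemma smooth_continuous: "smooth f \<Longrightarrow> continuous_on S f"
  using Ck.simps(1)[of f] by (simp only: smooth_def) (blast intro: continuous_on_subset)

lemma smooth_partial: "smooth f \<Longrightarrow> smooth (partial i f)"
  unfolding smooth_def using Ck.simps(2)[of _ f] by blast

lemma smooth_exp: "smooth f \<Longrightarrow> smooth (\<lambda>x. exp (f x))"
  unfolding smooth_def using Ck_compose[of "\<lambda>_. exp" f, OF DERIV_exp] by blast

lemma smooth_powr:
  assumes "smooth f" "\<And>x. f x > 0"
  shows "smooth (\<lambda>x. f x powr a)"
proof -
  \<comment> \<open>The \<open>n\<close>-th derivative of \<open>t powr a\<close>, with the falling
    factorial of \<open>a\<close> as coefficient.\<close>
  define G where "G n t = (\<Prod>j<n. a - real j) * t powr (a - real n)" for n and t :: real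
  have "(G n has_real_derivative G (Suc n) (f x)) (at (f x))" for n x
    unfolding G_def using assms(2)[of x]
    by (auto intro!: derivative_eq_intros simp: algebra_simps)
  from Ck_compose[of G f, OF this, where n = 0] show ?thesis
    using assms(1) by (simp add: smooth_def G_def)
qed

lemma smooth_ln:
  assumes "smooth f" "\<And>x. f x > 0"
  shows "smooth (\<lambda>x. ln (f x))"
proof -
  \<comment> \<open>From level one on, the tower of \<open>ln\<close> is the power tower with
    exponent -1, whose coefficients are the falling factorials of -1.\<close>
  define c where "c n = (\<Prod>j<n. - 1 - real j)" for n :: nat
  define G where "G n t = (case n of 0 \<Rightarrow> ln t | Suc m \<Rightarrow> c m * t powr (- 1 - real m))" for n and t :: real
  have "(G n has_real_derivative G (Suc n) (f x)) (at (f x))" for n x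
    unfolding G_def c_def using assms(2)[of x]
    by (cases n) (auto intro!: derivative_eq_intros simp: algebra_simps powr_minus_divide)
  from Ck_compose[of G f, OF this, where n = 0] show ?thesis
    using assms(1) by (simp add: smooth_def G_def)
qed

lemma smooth_inner_left: "smooth (\<lambda>x::real^'d::finite. (x - y) \<bullet> (x - y))"
proof -
  have "smooth (\<lambda>x::real^'d. \<Sum>i\<in>UNIV. (x $ i + - y $ i) * (x $ i + - y $ i))"
    by (intro smooth_sum smooth_mult smooth_add smooth_nth smooth_const)
  then show ?thesis by (simp add: inner_vec_def)
qed

text \<open>The derivative in the direction of the gradient itself is the square of its norm, and
  the Lipschitz bound limits the right difference quotients in that direction by \<open>L\<close>
  times the norm.\<close>

lemma norm_gradient_le_lipschitz:
  assumes L: "\<And>x y. f x \<le> f y + L * norm (x - y)" and f: "f differentiable at x"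
  shows "norm (gradient f x) \<le> L"
proof (cases "gradient f x = 0")
  case True
  \<comment> \<open>\<open>L\<close> is not assumed nonnegative; comparing two distinct points in
    both orders forces it.\<close>
  have "0 \<le> L * norm (axis undefined 1 :: real^'a)"
    using L[of 0 "axis undefined 1"] L[of "axis undefined 1" 0] by auto
  then show ?thesis using True by simp
next
  case False
  let ?v = "gradient f x"
  define g where "g s = f (x + s *\<^sub>R ?v)" for s
  have "((\<lambda>s. x + s *\<^sub>R ?v) has_derivative (\<lambda>s. s *\<^sub>R ?v)) (at 0)"
    by (auto intro!: derivative_eq_intros)
  from has_derivative_compose[OF this, of f "\<lambda>v. ?v \<bullet> v"] has_derivative_gradient[OF f]
  have "(g has_derivative (\<lambda>s. s *\<^sub>R (?v \<bullet> ?v))) (at 0)"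
    unfolding g_def by simp
  then have "(g has_real_derivative ?v \<bullet> ?v) (at 0)"
    by (simp add: has_field_derivative_def mult_commute_abs)
  then have "(\<lambda>h. (g h - g 0) / h) \<midarrow>0\<rightarrow> ?v \<bullet> ?v"
    by (simp add: DERIV_def)
  then have "((\<lambda>h. (g h - g 0) / h) \<longlongrightarrow> ?v \<bullet> ?v) (at_right 0)"
    by (rule filterlim_at_split[THEN iffD1, THEN conjunct2])
  moreover have "\<forall>\<^sub>F h in at_right 0. (g h - g 0) / h \<le> L * norm ?v"
    using eventually_at_right_less
  proof eventually_elim
    case (elim h)
    then show ?case using L[of "x + h *\<^sub>R ?v" x] by (simp add: g_def field_simps)
  qed
  ultimately have "?v \<bullet> ?v \<le> L * norm ?v"
    by (intro tendsto_upperbound) auto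
  then show ?thesis using False by (simp add: power2_norm_eq_inner[symmetric] power2_eq_square)
qed

subsection \<open>Smooth approximation of the distance function\<close>

text \<open>The soft minimum \<open>- ln (S x) / l\<close> is at most the minimum of the
  \<open>q y x\<close> and falls below it by at most \<open>ln (card T) / l\<close>, which is less
  than \<open>e\<close>; adding \<open>e\<close> therefore puts it above the distance. The error
  \<open>3 * e\<close> has one share each for this shift, for the net, and for the rounding in
  \<open>q\<close>.\<close>

lemma smooth_infdist_approx:
  fixes K :: "(real^'d::finite) set"
  assumes K: "compact K" "K \<noteq> {}" and e: "0 < e"
  obtains \<eta> where "smooth \<eta>" "\<And>x. infdist x K < \<eta> x" "\<And>x. \<eta> x \<le> infdist x K + 3 * e"
    "\<And>x. norm (gradient \<eta> x) \<le> 1"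
proof -
  obtain T where T: "T \<subseteq> K" "finite T" "K \<subseteq> (\<Union>y\<in>T. ball y e)"
    by (rule compactE_image[OF K(1), of K "\<lambda>y. ball y e"]) (use e in auto)
  with K(2) have "T \<noteq> {}" by auto
  \<comment> \<open>The distance to \<open>y\<close> rounded off so that it is smooth at
    \<open>y\<close> too. As a norm in the product space it is 1-Lipschitz by the triangle
    inequality.\<close>
  define q where "q y x = norm (x - y, e)" for x y :: "real^'d"
  \<comment> \<open>The summand 1 makes \<open>ln (card T) < l * e\<close> strict and keeps
    \<open>l\<close> positive when the net is a single point.\<close>
  define l where "l = (ln (card T) + 1) / e"
  define S where "S x = (\<Sum>y\<in>T. exp (- l * q y x))" for x
  define \<eta> where "\<eta> x = e + (- 1 / l) * ln (S x)" for x
  have n1: "real (card T) \<ge> 1" using T(2) \<open>T \<noteq> {}\<close> by (simp add: Suc_leI card_gt_0_iff)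
  have "ln (card T) \<ge> 0" using n1 by simp
  then have l: "l > 0" and le: "ln (card T) < l * e"
    using e by (auto simp: l_def)
  have S: "S x > 0" for x unfolding S_def using T(2) \<open>T \<noteq> {}\<close> by (intro sum_pos) auto
  have q_eq: "q y x = ((x - y) \<bullet> (x - y) + e\<^sup>2) powr (1/2)" for x y
    using powr_half_sqrt[of "(x - y) \<bullet> (x - y) + e\<^sup>2"] by (simp add: q_def norm_Pair power2_norm_eq_inner)
  have "smooth (q y)" for y
    unfolding q_eq[abs_def] using e
    by (intro smooth_powr smooth_add smooth_inner_left smooth_const) (simp add: add_nonneg_pos)
  then have "smooth S"
    unfolding S_def[abs_def] by (intro smooth_sum smooth_exp smooth_mult smooth_const)
  then have smooth: "smooth \<eta>"
    unfolding \<eta>_def[abs_def] by (intro smooth_add smooth_mult smooth_ln smooth_const S)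
  have lower: "infdist x K < \<eta> x" for x
  proof -
    have "S x \<le> (\<Sum>y\<in>T. exp (- l * infdist x K))"
      unfolding S_def
    proof (rule sum_mono)
      fix y assume "y \<in> T"
      then have "infdist x K \<le> dist x y" using T(1) by (intro infdist_le) auto
      also have "\<dots> \<le> q y x"
        using norm_fst_le[of "x - y" e] by (simp add: q_def dist_norm)
      finally show "exp (- l * q y x) \<le> exp (- l * infdist x K)" using l by simp
    qed
    then have "ln (S x) \<le> ln (card T * exp (- l * infdist x K))"
      using S[of x] by (simp add: ln_mono)
    also have "\<dots> = ln (card T) - l * infdist x K"
      using n1 by (subst ln_mult) auto
    finally have "l * infdist x K < l * e - ln (S x)" using le by linarith
    also have "\<dots> = l * \<eta> x" using l by (simp add: \<eta>_def field_simps)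
    finally show ?thesis using l by simp
  qed
  have upper: "\<eta> x \<le> infdist x K + 3 * e" for x
  proof -
    obtain p where p: "p \<in> K" "infdist x K = dist x p"
      using infdist_attains_inf[of K x] K by (auto simp: compact_imp_closed)
    then obtain y where y: "y \<in> T" "dist y p < e" using T(3) by auto
    have "exp (- l * q y x) \<le> S x"
      unfolding S_def using y T(2) by (intro member_le_sum) auto
    then have "- l * q y x \<le> ln (S x)" using S[of x] by (simp add: ln_ge_iff)
    then have "\<eta> x \<le> e + q y x" using l by (simp add: \<eta>_def field_simps)
    also have "q y x \<le> norm (x - y) + e"
      using norm_Pair_le[of "x - y" e] e by (simp add: q_def)
    also have "norm (x - y) \<le> infdist x K + e"
      using y(2) dist_triangle[of x y p] by (simp add: p(2) dist_norm norm_minus_commute)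
    finally show ?thesis by simp
  qed
  \<comment> \<open>Moving from \<open>z\<close> to \<open>x\<close> changes each exponential, hence
    also their sum, by a factor of at least \<open>exp (- l * norm (x - z))\<close>; the logarithm
    turns this into a Lipschitz constant independent of \<open>l\<close> and of the net.\<close>
  have lip: "\<eta> x \<le> \<eta> z + 1 * norm (x - z)" for x z
  proof -
    have "exp (- l * norm (x - z)) * S z \<le> S x"
      unfolding S_def sum_distrib_left
    proof (rule sum_mono)
      fix y
      have "q y x \<le> norm (x - z, 0::real) + q y z"
        unfolding q_def using norm_triangle_ineq[of "(x - z, 0)" "(z - y, e)"] by simp
      then have "l * q y x \<le> l * (norm (x - z) + q y z)"
        using l by (simp add: norm_Pair)
      then have "- l * norm (x - z) + - l * q y z \<le> - l * q y x"
        by (simp add: algebra_simps)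
      then show "exp (- l * norm (x - z)) * exp (- l * q y z) \<le> exp (- l * q y x)"
        unfolding exp_add[symmetric] by simp
    qed
    then have "ln (exp (- l * norm (x - z)) * S z) \<le> ln (S x)"
      using S[of x] S[of z] by (simp add: ln_mono)
    then have "- l * norm (x - z) + ln (S z) \<le> ln (S x)"
      using S[of z] by (simp add: ln_mult)
    then have "ln (S z) / l \<le> (ln (S x) + l * norm (x - z)) / l"
      using l by (simp add: divide_right_mono)
    also have "\<dots> = ln (S x) / l + norm (x - z)" using l by (simp add: add_divide_distrib)
    finally show ?thesis by (simp add: \<eta>_def)
  qed
  show thesis
    by (rule that[OF smooth lower upper norm_gradient_le_lipschitz[OF lip smooth_differentiable[OF smooth]]])
qed

subsection \<open>Hardy's inequality along lines\<close>

text \<open>The integrand is dominated pointwise by twice the derivative of \<open>- (g s)\<^sup>2 / s\<close> plus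
  \<open>4 * (g' s)\<^sup>2\<close>; no boundary condition at the right end of the interval is needed.\<close>

lemma hardy_half_line:
  fixes g g' :: "real \<Rightarrow> real"
  assumes g: "\<And>s. (g has_real_derivative g' s) (at s)" and g': "continuous_on UNIV g'"
    and c: "0 < c" "\<And>s. 0 < s \<Longrightarrow> s \<le> c \<Longrightarrow> g s = 0" and b: "\<And>s. b < s \<Longrightarrow> g s = 0"
  shows "(\<integral>\<^sup>+s\<in>{0<..}. ennreal ((g s)\<^sup>2 / s\<^sup>2) \<partial>lborel) \<le> (\<integral>\<^sup>+s. ennreal (4 * (g' s)\<^sup>2) \<partial>lborel)"
proof -
  define B where "B = max b c + 1"
  have cB: "c \<le> B" by (simp add: B_def)
  have gc: "continuous_on A g" for A
    using g DERIV_isCont continuous_at_imp_continuous_on by blast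
  have g'c: "continuous_on A g'" for A using g' continuous_on_subset by blast
  let ?X = "\<lambda>s. (g s)\<^sup>2 / s\<^sup>2"
  let ?Y = "\<lambda>s. 2 * ((g s)\<^sup>2 / s\<^sup>2 - 2 * g s * g' s / s)"
  let ?Z = "\<lambda>s. 4 * (g' s)\<^sup>2"
  have D: "((\<lambda>s. - 2 * (g s)\<^sup>2 / s) has_real_derivative ?Y s) (at s within {c..B})" if "s \<in> {c..B}" for s
    using that c(1)
    by (auto intro!: derivative_eq_intros has_field_derivative_at_within[OF g] simp: field_simps power2_eq_square)
  have Y: "(?Y has_integral (- 2 * (g B)\<^sup>2 / B - (- 2 * (g c)\<^sup>2 / c))) {c..B}"
    by (rule fundamental_theorem_of_calculus[OF cB])
      (use D in \<open>simp add: has_real_derivative_iff_has_vector_derivative\<close>)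
  have X: "?X integrable_on {c..B}"
    using c(1) by (intro integrable_continuous_interval continuous_intros gc) auto
  have Z: "?Z integrable_on {c..B}"
    by (intro integrable_continuous_interval continuous_intros g'c)
  have "?X s \<le> ?Y s + ?Z s" if "s \<in> {c..B}" for s
  proof -
    define r where "r = g s / s"
    \<comment> \<open>Completing the square is the source of the factor 4, the sharp constant of the
      one-dimensional inequality.\<close>
    have "0 \<le> (r - 2 * g' s)\<^sup>2" by simp
    then have "r\<^sup>2 \<le> 2 * (r\<^sup>2 - 2 * r * g' s) + 4 * (g' s)\<^sup>2"
      by (simp add: power2_eq_square algebra_simps)
    then show ?thesis by (simp add: r_def power_divide)
  qed
  then have "integral {c..B} ?X \<le> integral {c..B} (\<lambda>s. ?Y s + ?Z s)"
    using X Y Z by (intro integral_le integrable_add) auto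
  also have "\<dots> = integral {c..B} ?Y + integral {c..B} ?Z"
    using Y Z by (intro integral_add) auto
  also have "integral {c..B} ?Y = - 2 * (g B)\<^sup>2 / B - (- 2 * (g c)\<^sup>2 / c)"
    using Y by (rule integral_unique)
  also have "\<dots> = 0" using c b[of B] by (simp add: B_def)
  finally have XZ: "integral {c..B} ?X \<le> integral {c..B} ?Z" by simp
  have nn: "(\<integral>\<^sup>+s\<in>{c..B}. ennreal (h s) \<partial>lborel) = ennreal (integral {c..B} h)"
    if "h integrable_on {c..B}" "\<And>s. 0 \<le> h s" "h \<in> borel_measurable borel" for h
    using that by (intro nn_integral_has_integral_lebesgue' integrable_integral) auto
  have gm: "g \<in> borel_measurable borel" "g' \<in> borel_measurable borel"
    using gc g' by (auto intro: borel_measurable_continuous_onI)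
  have "(\<integral>\<^sup>+s\<in>{0<..}. ennreal (?X s) \<partial>lborel) = (\<integral>\<^sup>+s\<in>{c..B}. ennreal (?X s) \<partial>lborel)"
    using c b by (intro nn_integral_cong) (auto simp: indicator_def B_def)
  also have "\<dots> = ennreal (integral {c..B} ?X)"
    using gm by (intro nn X) auto
  also have "\<dots> \<le> ennreal (integral {c..B} ?Z)" using XZ by (simp add: ennreal_leI)
  also have "\<dots> = (\<integral>\<^sup>+s\<in>{c..B}. ennreal (?Z s) \<partial>lborel)"
    using gm by (intro nn[symmetric] Z) auto
  also have "\<dots> \<le> (\<integral>\<^sup>+s. ennreal (?Z s) \<partial>lborel)"
    by (intro nn_integral_mono) (auto simp: indicator_def)
  finally show ?thesis .
qed

text \<open>Integrating over the slab \<open>0 < x \<bullet> \<nu> < 1\<close> and along the lines in direction \<open>\<nu>\<close> avoids rotating coordinates.\<close>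

lemma nn_integral_slab_lines:
  fixes F :: "'a::euclidean_space \<Rightarrow> ennreal"
  assumes F[measurable]: "F \<in> borel_measurable borel" and \<nu>: "norm \<nu> = 1"
  shows "(\<integral>\<^sup>+x. (\<integral>\<^sup>+s. F (x + s *\<^sub>R \<nu>) \<partial>lborel) * indicator {x. 0 < x \<bullet> \<nu> \<and> x \<bullet> \<nu> < 1} x \<partial>lborel)
    = (\<integral>\<^sup>+x. F x \<partial>lborel)"
proof -
  let ?P = "{x. 0 < x \<bullet> \<nu> \<and> x \<bullet> \<nu> < 1}"
  have [measurable]: "?P \<in> sets borel" by measurable
  have "(\<integral>\<^sup>+x. (\<integral>\<^sup>+s. F (x + s *\<^sub>R \<nu>) \<partial>lborel) * indicator ?P x \<partial>lborel)
      = (\<integral>\<^sup>+x. (\<integral>\<^sup>+s. F (x + s *\<^sub>R \<nu>) * indicator ?P x \<partial>lborel) \<partial>lborel)"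
    by (intro nn_integral_cong nn_integral_multc[symmetric]) measurable
  also have "\<dots> = (\<integral>\<^sup>+s. (\<integral>\<^sup>+x. F (x + s *\<^sub>R \<nu>) * indicator ?P x \<partial>lborel) \<partial>lborel)"
    by (rule lborel_pair.Fubini'[symmetric]) measurable
  also have "\<dots> = (\<integral>\<^sup>+s. (\<integral>\<^sup>+x. F x * indicator ?P (x - s *\<^sub>R \<nu>) \<partial>lborel) \<partial>lborel)"
  proof (rule nn_integral_cong)
    fix s :: real
    have "(\<integral>\<^sup>+x. F x * indicator ?P (x - s *\<^sub>R \<nu>) \<partial>lborel)
      = (\<integral>\<^sup>+x. F x * indicator ?P (x - s *\<^sub>R \<nu>) \<partial>distr lborel borel ((+) (s *\<^sub>R \<nu>)))"
      by (simp add: lborel_distr_plus)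
    also have "\<dots> = (\<integral>\<^sup>+x. F (x + s *\<^sub>R \<nu>) * indicator ?P x \<partial>lborel)"
      by (subst nn_integral_distr) (auto simp: add.commute)
    finally show "(\<integral>\<^sup>+x. F (x + s *\<^sub>R \<nu>) * indicator ?P x \<partial>lborel) = (\<integral>\<^sup>+x. F x * indicator ?P (x - s *\<^sub>R \<nu>) \<partial>lborel)" ..
  qed
  also have "\<dots> = (\<integral>\<^sup>+x. (\<integral>\<^sup>+s. F x * indicator ?P (x - s *\<^sub>R \<nu>) \<partial>lborel) \<partial>lborel)"
    by (rule lborel_pair.Fubini') measurable
  also have "\<dots> = (\<integral>\<^sup>+x. F x * (\<integral>\<^sup>+s. indicator ?P (x - s *\<^sub>R \<nu>) \<partial>lborel) \<partial>lborel)"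
    by (intro nn_integral_cong nn_integral_cmult) measurable
  also have "\<dots> = (\<integral>\<^sup>+x. F x \<partial>lborel)"
  proof (rule nn_integral_cong)
    \<comment> \<open>The parameters \<open>s\<close> that move \<open>x\<close> back into the slab
      form an interval of length one. This is why the slab has unit width.\<close>
    fix x :: 'a
    have "(\<integral>\<^sup>+s. indicator ?P (x - s *\<^sub>R \<nu>) \<partial>lborel) = (\<integral>\<^sup>+s. indicator {x \<bullet> \<nu> - 1<..<x \<bullet> \<nu>} s \<partial>lborel)"
      using \<nu> by (intro nn_integral_cong) (auto simp: indicator_def inner_diff_left norm_eq_1)
    also have "\<dots> = 1" by simp
    finally show "F x * (\<integral>\<^sup>+s. indicator ?P (x - s *\<^sub>R \<nu>) \<partial>lborel) = F x" by simp
  qed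
  finally show ?thesis .
qed

text \<open>Both integrals are integrals of line integrals over the same slab, so a comparison on
  every line suffices.\<close>

lemma nn_integral_le_by_lines:
  fixes F G :: "'a::euclidean_space \<Rightarrow> ennreal"
  assumes "F \<in> borel_measurable borel" "G \<in> borel_measurable borel" "norm \<nu> = 1"
    and "\<And>x. (\<integral>\<^sup>+s. F (x + s *\<^sub>R \<nu>) \<partial>lborel) \<le> (\<integral>\<^sup>+s. G (x + s *\<^sub>R \<nu>) \<partial>lborel)"
  shows "(\<integral>\<^sup>+x. F x \<partial>lborel) \<le> (\<integral>\<^sup>+x. G x \<partial>lborel)"
  unfolding nn_integral_slab_lines[OF assms(1,3), symmetric] nn_integral_slab_lines[OF assms(2,3), symmetric]
  by (intro nn_integral_mono mult_right_mono assms(4)) simp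

lemma test_fn_smooth: "test_fn U \<phi> \<Longrightarrow> smooth \<phi>"
  by (simp add: test_fn_def smooth_def)

lemma continuous_on_gradient:
  assumes "smooth \<phi>" shows "continuous_on S (gradient \<phi>)"
  unfolding gradient_def[abs_def]
  by (intro continuous_intros smooth_continuous smooth_partial assms)

lemma DERIV_along_line:
  assumes "smooth \<phi>"
  shows "((\<lambda>s. \<phi> (x + s *\<^sub>R \<nu>)) has_real_derivative gradient \<phi> (x + s *\<^sub>R \<nu>) \<bullet> \<nu>) (at s)"
proof -
  have "((\<lambda>s. x + s *\<^sub>R \<nu>) has_derivative (\<lambda>s. s *\<^sub>R \<nu>)) (at s)"
    by (auto intro!: derivative_eq_intros)
  from has_derivative_compose[OF this has_derivative_gradient[OF smooth_differentiable[OF assms]]]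
  show ?thesis by (simp add: has_field_derivative_def mult_commute_abs)
qed

text \<open>\<open>\<tau>\<close> measures height along \<open>\<nu>\<close> above a possibly curved
  surface, and \<open>x - \<tau> x *\<^sub>R \<nu>\<close> is the foot of the line through
  \<open>x\<close>. The foot lies outside \<open>U\<close> while the support of
  \<open>\<phi>\<close> is a compact subset of \<open>U\<close>, so \<open>\<phi>\<close> vanishes
  near the foot and the one-dimensional inequality can start there. Graph charts and supporting
  hyperplanes are both instances.\<close>

lemma hardy_direction:
  fixes \<phi> \<tau> :: "real^'d::finite \<Rightarrow> real"
  assumes \<phi>: "test_fn U \<phi>" and \<nu>: "norm \<nu> = 1"
    and [measurable]: "S \<in> sets borel" "\<tau> \<in> borel_measurable borel"
    and \<tau>: "\<And>x s. \<tau> (x + s *\<^sub>R \<nu>) = \<tau> x + s"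
    and S: "\<And>x. x \<in> S \<Longrightarrow> 0 < \<tau> x" "\<And>x. x \<in> S \<Longrightarrow> x - \<tau> x *\<^sub>R \<nu> \<notin> U"
  shows "(\<integral>\<^sup>+x\<in>S. ennreal ((\<phi> x)\<^sup>2 / (\<tau> x)\<^sup>2) \<partial>lborel)
    \<le> (\<integral>\<^sup>+x. ennreal (4 * (norm (gradient \<phi> x))\<^sup>2) \<partial>lborel)"
proof (rule nn_integral_le_by_lines[OF _ _ \<nu>])
  note sm = test_fn_smooth[OF \<phi>]
  have [measurable]: "\<phi> \<in> borel_measurable borel" "gradient \<phi> \<in> borel_measurable borel"
    using sm by (auto intro!: borel_measurable_continuous_onI smooth_continuous continuous_on_gradient)
  show "(\<lambda>x. ennreal ((\<phi> x)\<^sup>2 / (\<tau> x)\<^sup>2) * indicator S x) \<in> borel_measurable borel"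
    "(\<lambda>x. ennreal (4 * (norm (gradient \<phi> x))\<^sup>2)) \<in> borel_measurable borel"
    by measurable
  fix x
  let ?F = "\<lambda>x. ennreal ((\<phi> x)\<^sup>2 / (\<tau> x)\<^sup>2) * indicator S x"
  let ?G = "\<lambda>x. ennreal (4 * (norm (gradient \<phi> x))\<^sup>2)"
  show "(\<integral>\<^sup>+s. ?F (x + s *\<^sub>R \<nu>) \<partial>lborel) \<le> (\<integral>\<^sup>+s. ?G (x + s *\<^sub>R \<nu>) \<partial>lborel)"
  proof (cases "\<exists>s. x + s *\<^sub>R \<nu> \<in> S")
    case False
    then show ?thesis by simp
  next
    case True
    then obtain s1 where s1: "x + s1 *\<^sub>R \<nu> \<in> S" by blast
    \<comment> \<open>Starting the line at its foot makes the parameter \<open>s\<close> equal to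
      the height \<open>\<tau>\<close>.\<close>
    define x0 where "x0 = x - \<tau> x *\<^sub>R \<nu>"
    have shift: "(\<integral>\<^sup>+s. H (x + s *\<^sub>R \<nu>) \<partial>lborel) = (\<integral>\<^sup>+s. H (x0 + s *\<^sub>R \<nu>) \<partial>lborel)"
      if [measurable]: "H \<in> borel_measurable borel" for H :: "real^'d \<Rightarrow> ennreal"
    proof -
      have "x + (- \<tau> x + 1 * s) *\<^sub>R \<nu> = x0 + s *\<^sub>R \<nu>" for s
        by (simp add: x0_def algebra_simps)
      moreover have "(\<integral>\<^sup>+s. H (x + s *\<^sub>R \<nu>) \<partial>lborel)
          = ennreal \<bar>1\<bar> * (\<integral>\<^sup>+s. H (x + (- \<tau> x + 1 * s) *\<^sub>R \<nu>) \<partial>lborel)"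
        by (rule nn_integral_real_affine) auto
      ultimately show ?thesis by (simp only: abs_one ennreal_1 mult_1)
    qed
    have \<tau>0: "\<tau> (x0 + s *\<^sub>R \<nu>) = s" for s
      using \<tau>[of x "- \<tau> x"] \<tau>[of x0 s] by (simp add: x0_def)
    \<comment> \<open>All points of one line share the same foot, so a single point of
      \<open>S\<close> on the line already shows that \<open>x0\<close> lies outside
      \<open>U\<close>.\<close>
    have "x0 = x + s1 *\<^sub>R \<nu> - \<tau> (x + s1 *\<^sub>R \<nu>) *\<^sub>R \<nu>"
      unfolding \<tau> by (simp add: x0_def algebra_simps)
    with S(2)[OF s1] have "x0 \<notin> U" by simp
    let ?C = "closure {x. \<phi> x \<noteq> 0}"
    have C: "compact ?C" "x0 \<notin> ?C" using \<phi> \<open>x0 \<notin> U\<close> by (auto simp: test_fn_def)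
    have zero: "\<phi> y = 0" if "y \<notin> ?C" for y
      using that closure_subset[of "{x. \<phi> x \<noteq> 0}"] by auto
    have "open (- ?C)" by (simp add: open_Compl)
    then obtain e where e: "0 < e" "ball x0 e \<subseteq> - ?C"
      using C(2) unfolding open_contains_ball by blast
    obtain R where R: "\<And>y. y \<in> ?C \<Longrightarrow> dist x0 y \<le> R"
      using compact_imp_bounded[OF C(1)] bounded_any_center[of ?C x0] by blast
    define g g' where "g s = \<phi> (x0 + s *\<^sub>R \<nu>)" and "g' s = gradient \<phi> (x0 + s *\<^sub>R \<nu>) \<bullet> \<nu>" for s
    have dist: "dist x0 (x0 + s *\<^sub>R \<nu>) = \<bar>s\<bar>" for s by (simp add: dist_norm \<nu>)
    have hardy: "(\<integral>\<^sup>+s\<in>{0<..}. ennreal ((g s)\<^sup>2 / s\<^sup>2) \<partial>lborel) \<le> (\<integral>\<^sup>+s. ennreal (4 * (g' s)\<^sup>2) \<partial>lborel)"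
    proof (rule hardy_half_line[where c = "e / 2" and b = "\<bar>R\<bar>"])
      show "(g has_real_derivative g' s) (at s)" for s
        unfolding g_def[abs_def] g'_def by (rule DERIV_along_line[OF sm])
      show "continuous_on UNIV g'" unfolding g'_def[abs_def]
        by (intro continuous_intros continuous_on_compose2[OF continuous_on_gradient[OF sm, of UNIV]]) auto
      show "0 < e / 2" using e(1) by simp
      fix s assume "0 < s" "s \<le> e / 2"
      then have "x0 + s *\<^sub>R \<nu> \<in> ball x0 e" unfolding mem_ball dist using e(1) by linarith
      then have "x0 + s *\<^sub>R \<nu> \<notin> ?C" using e(2) by blast
      then show "g s = 0" unfolding g_def by (rule zero)
    next
      fix s assume "\<bar>R\<bar> < s"
      then have "x0 + s *\<^sub>R \<nu> \<notin> ?C" using R[of "x0 + s *\<^sub>R \<nu>"] by (auto simp: dist)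
      then show "g s = 0" unfolding g_def by (rule zero)
    qed
    have "(\<integral>\<^sup>+s. ?F (x + s *\<^sub>R \<nu>) \<partial>lborel) = (\<integral>\<^sup>+s. ?F (x0 + s *\<^sub>R \<nu>) \<partial>lborel)"
      by (rule shift) measurable
    also have "\<dots> \<le> (\<integral>\<^sup>+s\<in>{0<..}. ennreal ((g s)\<^sup>2 / s\<^sup>2) \<partial>lborel)"
    proof (rule nn_integral_mono)
      fix s
      have "s > 0" if "x0 + s *\<^sub>R \<nu> \<in> S" using S(1)[OF that] by (simp add: \<tau>0)
      then show "?F (x0 + s *\<^sub>R \<nu>) \<le> ennreal ((g s)\<^sup>2 / s\<^sup>2) * indicator {0<..} s"
        by (auto simp: indicator_def \<tau>0 g_def)
    qed
    also note hardy
    also have "(\<integral>\<^sup>+s. ennreal (4 * (g' s)\<^sup>2) \<partial>lborel) \<le> (\<integral>\<^sup>+s. ?G (x0 + s *\<^sub>R \<nu>) \<partial>lborel)"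
    proof (intro nn_integral_mono ennreal_leI mult_left_mono)
      fix s
      have "\<bar>g' s\<bar> \<le> norm (gradient \<phi> (x0 + s *\<^sub>R \<nu>))"
        using Cauchy_Schwarz_ineq2[of "gradient \<phi> (x0 + s *\<^sub>R \<nu>)" \<nu>] by (simp add: g'_def \<nu>)
      then show "(g' s)\<^sup>2 \<le> (norm (gradient \<phi> (x0 + s *\<^sub>R \<nu>)))\<^sup>2"
        by (simp add: abs_le_square_iff[symmetric])
    qed simp
    also have "\<dots> = (\<integral>\<^sup>+s. ?G (x + s *\<^sub>R \<nu>) \<partial>lborel)"
      by (rule shift[symmetric]) measurable
    finally show ?thesis .
  qed
qed

subsection \<open>Geometry of Lipschitz domains\<close>

lemma hproj_inner: "norm \<nu> = 1 \<Longrightarrow> hproj \<nu> y \<bullet> \<nu> = 0"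
  by (simp add: hproj_def inner_diff_left norm_eq_1)

lemma hproj_add_scaleR: "norm \<nu> = 1 \<Longrightarrow> hproj \<nu> (y + s *\<^sub>R \<nu>) = hproj \<nu> y"
  by (simp add: hproj_def inner_add_left norm_eq_1 algebra_simps)

lemma hproj_diff: "hproj \<nu> (x - y) = hproj \<nu> x - hproj \<nu> y"
  by (simp add: hproj_def inner_diff_left algebra_simps)

lemma norm_hproj_le:
  assumes "norm \<nu> = 1" shows "norm (hproj \<nu> y) \<le> norm y"
proof -
  have "orthogonal (hproj \<nu> y) ((y \<bullet> \<nu>) *\<^sub>R \<nu>)"
    by (simp add: orthogonal_def hproj_inner[OF assms])
  from norm_add_Pythagorean[OF this]
  have "(norm y)\<^sup>2 = (norm (hproj \<nu> y))\<^sup>2 + (norm ((y \<bullet> \<nu>) *\<^sub>R \<nu>))\<^sup>2"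
    unfolding hproj_def by simp
  then have "(norm (hproj \<nu> y))\<^sup>2 \<le> (norm y)\<^sup>2" by simp
  then show ?thesis by (rule power2_le_imp_le) simp
qed

lemma continuous_on_hproj: "continuous_on S (\<lambda>x. hproj \<nu> (x - z))"
  unfolding hproj_def by (intro continuous_intros)

text \<open>The vertical height over the graph is comparable to the distance to the frontier. A
  frontier point \<open>y\<close> in the large cylinder is not above the graph, which gives the
  factor \<open>M + 1\<close>. A frontier point outside it is at least \<open>r / 4\<close> away
  from the smaller cylinder, where the height is at most \<open>7 * (M + 1) * r\<close>; hence 28 =
  4 * 7.\<close>

lemma lipschitz_graph_chart:
  fixes \<Omega> :: "(real^'d::finite) set"
  assumes \<Omega>: "open \<Omega>" and r: "0 < r" and M: "0 \<le> M" and \<nu>: "norm \<nu> = 1"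
    and \<psi>: "M-lipschitz_on {y. y \<bullet> \<nu> = 0} \<psi>" "\<psi> 0 = 0"
    and chart: "\<Omega> \<inter> cyl z \<nu> r (10 * (M + 1) * r)
      = {x \<in> cyl z \<nu> r (10 * (M + 1) * r). (x - z) \<bullet> \<nu> > \<psi> (hproj \<nu> (x - z))}"
  defines "\<tau> \<equiv> \<lambda>x. (x - z) \<bullet> \<nu> - \<psi> (hproj \<nu> (x - z))"
  assumes x: "x \<in> \<Omega>" "x \<in> cyl z \<nu> (3/4 * r) (6 * (M + 1) * r)"
  shows "0 < \<tau> x" "x - \<tau> x *\<^sub>R \<nu> \<notin> \<Omega>" "y \<in> frontier \<Omega> \<Longrightarrow> \<tau> x \<le> 28 * (M + 1) * dist x y"
proof -
  let ?C = "cyl z \<nu> r (10 * (M + 1) * r)"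
  \<comment> \<open>With \<open>M * r\<close> rewritten as \<open>k - r\<close>, the remaining size
    estimates are linear in \<open>k\<close> and \<open>r\<close>.\<close>
  define k where "k = (M + 1) * r"
  have k: "M * r = k - r" "r \<le> k"
    using M r by (simp_all add: k_def distrib_right)
  have k': "6 * (M + 1) * r = 6 * k" "10 * (M + 1) * r = 10 * k"
    by (simp_all add: k_def algebra_simps)
  have C_eq: "?C = {w. norm (hproj \<nu> (w - z)) < r \<and> \<bar>(w - z) \<bullet> \<nu>\<bar> < 10 * k}"
    unfolding cyl_def k' by (rule refl)
  have xs: "norm (hproj \<nu> (x - z)) < 3/4 * r" "\<bar>(x - z) \<bullet> \<nu>\<bar> < 6 * k"
    using x(2) unfolding cyl_def k' by blast+
  have "x \<in> ?C" unfolding C_eq mem_Collect_eq using xs k r by linarith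
  then show pos: "0 < \<tau> x" using x(1) chart by (auto simp: \<tau>_def)
  have \<psi>_dist: "\<bar>\<psi> (hproj \<nu> v) - \<psi> (hproj \<nu> w)\<bar> \<le> M * norm (hproj \<nu> v - hproj \<nu> w)" for v w
    using lipschitz_onD[OF \<psi>(1), of "hproj \<nu> v" "hproj \<nu> w"] hproj_inner[OF \<nu>]
    by (simp add: dist_norm)
  have "\<bar>\<psi> (hproj \<nu> (x - z))\<bar> \<le> M * norm (hproj \<nu> (x - z))"
    using \<psi>_dist[of "x - z" 0] \<psi>(2) by (simp add: hproj_def)
  also have "\<dots> \<le> M * r" using M xs r by (intro mult_left_mono) auto
  finally have \<psi>x: "\<bar>\<psi> (hproj \<nu> (x - z))\<bar> \<le> M * r" .
  show "x - \<tau> x *\<^sub>R \<nu> \<notin> \<Omega>"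
  proof
    let ?y = "x - \<tau> x *\<^sub>R \<nu>"
    assume "?y \<in> \<Omega>"
    have yz: "?y - z = (x - z) + (- \<tau> x) *\<^sub>R \<nu>" by simp
    have h: "hproj \<nu> (?y - z) = hproj \<nu> (x - z)" unfolding yz by (rule hproj_add_scaleR[OF \<nu>])
    have i: "(?y - z) \<bullet> \<nu> = \<psi> (hproj \<nu> (x - z))"
      unfolding yz using \<nu> by (simp add: inner_add_left norm_eq_1 \<tau>_def)
    \<comment> \<open>The foot lies on the graph at height at most \<open>M * r\<close>, still
      inside the large cylinder, so the chart applies there and its strict inequality fails.\<close>
    have "?y \<in> ?C" unfolding C_eq mem_Collect_eq h i using xs \<psi>x k r by linarith
    with \<open>?y \<in> \<Omega>\<close> chart have "(?y - z) \<bullet> \<nu> > \<psi> (hproj \<nu> (?y - z))" by blast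
    then show False unfolding h i by simp
  qed
  assume y: "y \<in> frontier \<Omega>"
  then have "y \<notin> \<Omega>" using \<Omega> by (simp add: frontier_def interior_open)
  have hd: "norm (hproj \<nu> (x - z) - hproj \<nu> (y - z)) \<le> dist x y"
    using norm_hproj_le[OF \<nu>, of "x - y"] by (simp add: hproj_diff[symmetric] dist_norm)
  have id: "\<bar>(x - z) \<bullet> \<nu> - (y - z) \<bullet> \<nu>\<bar> \<le> dist x y"
    using Cauchy_Schwarz_ineq2[of "x - y" \<nu>] \<nu> by (simp add: inner_diff_left dist_norm)
  show "\<tau> x \<le> 28 * (M + 1) * dist x y"
  proof (cases "y \<in> ?C")
    case True
    then have "\<not> (y - z) \<bullet> \<nu> > \<psi> (hproj \<nu> (y - z))" using \<open>y \<notin> \<Omega>\<close> chart by blast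
    then have "\<tau> x \<le> ((x - z) \<bullet> \<nu> - (y - z) \<bullet> \<nu>) + (\<psi> (hproj \<nu> (y - z)) - \<psi> (hproj \<nu> (x - z)))"
      by (simp add: \<tau>_def)
    also have "\<dots> \<le> dist x y + M * dist x y"
      using id \<psi>_dist[of "x - z" "y - z"] mult_left_mono[OF hd M] by linarith
    also have "\<dots> \<le> 28 * (M + 1) * dist x y"
      using M by (simp add: algebra_simps)
    finally show ?thesis .
  next
    case False
    have "norm (hproj \<nu> (y - z)) \<le> norm (hproj \<nu> (x - z)) + norm (hproj \<nu> (x - z) - hproj \<nu> (y - z))"
      using norm_triangle_ineq4[of "hproj \<nu> (x - z)" "hproj \<nu> (x - z) - hproj \<nu> (y - z)"] by simp
    moreover have "r \<le> norm (hproj \<nu> (y - z)) \<or> 10 * k \<le> \<bar>(y - z) \<bullet> \<nu>\<bar>"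
      using False unfolding C_eq mem_Collect_eq not_less[symmetric] by blast
    ultimately have "r / 4 \<le> dist x y"
      using hd id xs r k by linarith
    then have "28 * (M + 1) * (r / 4) \<le> 28 * (M + 1) * dist x y"
      using M by (intro mult_left_mono) auto
    moreover have "\<tau> x \<le> 7 * k"
      using xs \<psi>x k r unfolding \<tau>_def by linarith
    moreover have "28 * (M + 1) * (r / 4) = 7 * k"
      by (simp add: k_def)
    ultimately show ?thesis by linarith
  qed
qed

lemma cyl_dist:
  assumes "norm \<nu> = 1" "x \<in> cyl z \<nu> r h"
  shows "dist x z < r + h"
proof -
  have "x - z = hproj \<nu> (x - z) + ((x - z) \<bullet> \<nu>) *\<^sub>R \<nu>" by (simp add: hproj_def)
  then have "norm (x - z) \<le> norm (hproj \<nu> (x - z)) + \<bar>(x - z) \<bullet> \<nu>\<bar>"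
    using norm_triangle_ineq[of "hproj \<nu> (x - z)" "((x - z) \<bullet> \<nu>) *\<^sub>R \<nu>"] assms(1) by simp
  then show ?thesis using assms(2) by (simp add: cyl_def dist_norm)
qed

lemma cyl_enlarge:
  assumes "norm \<nu> = 1" "y \<in> cyl z \<nu> r h" "dist x y < e" "r + e \<le> r'" "h + e \<le> h'"
  shows "x \<in> cyl z \<nu> r' h'"
proof -
  have "norm (hproj \<nu> (x - z)) \<le> norm (hproj \<nu> (y - z)) + norm (hproj \<nu> (x - y))"
    using norm_triangle_ineq[of "hproj \<nu> (y - z)" "hproj \<nu> (x - y)"] by (simp add: hproj_diff)
  moreover have "norm (hproj \<nu> (x - y)) < e"
    using norm_hproj_le[OF assms(1), of "x - y"] assms(3) by (simp add: dist_norm)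
  moreover have "\<bar>(x - z) \<bullet> \<nu> - (y - z) \<bullet> \<nu>\<bar> < e"
    using Cauchy_Schwarz_ineq2[of "x - y" \<nu>] assms(1,3) by (simp add: inner_diff_left dist_norm)
  ultimately show ?thesis using assms by (auto simp: cyl_def)
qed

text \<open>Subadditivity of Lebesgue measure; the covering intervals may overlap.\<close>

lemma interval_length_le_cover:
  fixes c :: "nat \<Rightarrow> real"
  assumes "{a..b} \<subseteq> (\<Union>l<N. {c l - R..c l + R})" "0 \<le> R" "a \<le> b"
  shows "b - a \<le> real N * (2 * R)"
proof -
  have "b - a = measure lborel {a..b}" using assms(3) by simp
  also have "\<dots> \<le> measure lborel (\<Union>l<N. {c l - R..c l + R})"
    using assms(1) by (intro measure_mono_fmeasurable fmeasurable_compact compact_UN) auto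
  also have "\<dots> \<le> (\<Sum>l<N. measure lborel {c l - R..c l + R})"
    by (intro measure_UNION_le) auto
  finally show ?thesis using assms(2) by simp
qed

lemma connected_inner_between:
  fixes \<Omega> :: "'a::euclidean_space set"
  assumes "connected \<Omega>" "x \<in> \<Omega>" "y \<in> \<Omega>" "x \<bullet> e \<le> t" "t \<le> y \<bullet> e"
  obtains p where "p \<in> \<Omega>" "p \<bullet> e = t"
proof -
  have "connected ((\<lambda>p. p \<bullet> e) ` \<Omega>)"
    by (intro connected_continuous_image continuous_intros assms(1))
  then have "t \<in> (\<lambda>p. p \<bullet> e) ` \<Omega>"
    by (rule connectedD_interval) (use assms in auto)
  then show thesis using that by auto
qed

text \<open>Every line orthogonal to \<open>e\<close> through a point of the domain hits the frontier, so the frontier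
  and the domain have the same shadow on \<open>e\<close>.\<close>

lemma width_le_of_frontier_cover:
  fixes \<Omega> :: "'a::euclidean_space set"
  assumes \<Omega>: "bounded \<Omega>" "connected \<Omega>" and cover: "frontier \<Omega> \<subseteq> (\<Union>l<N. cball (z l) R)" and R: "0 \<le> R"
    and e: "norm e = 1" "norm e' = 1" "e' \<bullet> e = 0" and xy: "x \<in> \<Omega>" "y \<in> \<Omega>"
  shows "x \<bullet> e - y \<bullet> e \<le> real N * (2 * R)"
proof (cases "y \<bullet> e \<le> x \<bullet> e")
  case True
  have "{y \<bullet> e..x \<bullet> e} \<subseteq> (\<Union>l<N. {z l \<bullet> e - R..z l \<bullet> e + R})"
  proof
    fix t assume "t \<in> {y \<bullet> e..x \<bullet> e}"
    then obtain p where p: "p \<in> \<Omega>" "p \<bullet> e = t"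
      using connected_inner_between[OF \<Omega>(2) xy(2,1)] by auto
    obtain B where B: "\<And>w. w \<in> \<Omega> \<Longrightarrow> dist p w \<le> B"
      using \<Omega>(1) bounded_any_center[of \<Omega> p] by blast
    let ?L = "range (\<lambda>s. p + s *\<^sub>R e')"
    \<comment> \<open>A point of the line that is too far from \<open>p\<close> for the bounded
      domain, so the line meets both the domain and its complement.\<close>
    have "p + (\<bar>B\<bar> + 1) *\<^sub>R e' \<notin> \<Omega>"
      using B[of "p + (\<bar>B\<bar> + 1) *\<^sub>R e'"] e(2) by (auto simp: dist_norm)
    moreover have "p \<in> ?L \<inter> \<Omega>" using p(1) range_eqI[of p "\<lambda>s. p + s *\<^sub>R e'" 0] by simp
    moreover have "connected ?L"
      by (intro connected_continuous_image continuous_intros connected_UNIV)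
    ultimately have "?L \<inter> frontier \<Omega> \<noteq> {}" by (intro connected_Int_frontier) blast+
    then obtain s where s: "p + s *\<^sub>R e' \<in> frontier \<Omega>" by auto
    then obtain l where l: "l < N" "dist (z l) (p + s *\<^sub>R e') \<le> R" using cover by auto
    have "\<bar>(z l - (p + s *\<^sub>R e')) \<bullet> e\<bar> \<le> R"
      using Cauchy_Schwarz_ineq2[of "z l - (p + s *\<^sub>R e')" e] e(1) l(2) by (simp add: dist_norm)
    then have "\<bar>z l \<bullet> e - t\<bar> \<le> R" using p(2) e(3) by (simp add: inner_diff_left inner_add_left)
    then show "t \<in> (\<Union>l<N. {z l \<bullet> e - R..z l \<bullet> e + R})" using l(1) by (auto simp: abs_le_iff algebra_simps intro!: bexI[of _ l])
  qed
  from interval_length_le_cover[OF this R True] show ?thesis .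
next
  case False
  then show ?thesis using R by (smt (verit) mult_nonneg_nonneg of_nat_0_le_iff)
qed

text \<open>A Poincare inequality in Hardy form: the supporting hyperplane with normal
  \<open>\<nu>\<close> takes the place of the graph. Openness keeps the infimum \<open>a\<close>
  from being attained, so the heights are positive and all feet lie outside the domain.\<close>

lemma hardy_slab:
  fixes \<Omega> :: "(real^'d::finite) set"
  assumes \<phi>: "test_fn \<Omega> \<phi>" and \<Omega>: "open \<Omega>" "bounded \<Omega>" and \<nu>: "norm \<nu> = 1"
  defines "a \<equiv> Inf ((\<lambda>x. x \<bullet> \<nu>) ` \<Omega>)"
  shows "(\<integral>\<^sup>+x\<in>\<Omega>. ennreal ((\<phi> x)\<^sup>2 / (x \<bullet> \<nu> - a)\<^sup>2) \<partial>lborel)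
      \<le> (\<integral>\<^sup>+x. ennreal (4 * (norm (gradient \<phi> x))\<^sup>2) \<partial>lborel)"
    and "x \<in> \<Omega> \<Longrightarrow> a < x \<bullet> \<nu>"
proof -
  have bd: "bdd_below ((\<lambda>x. x \<bullet> \<nu>) ` \<Omega>)"
    by (rule bounded_imp_bdd_below[OF bounded_linear_image[OF \<Omega>(2) bounded_linear_inner_left]])
  show less: "a < x \<bullet> \<nu>" if x: "x \<in> \<Omega>" for x
  proof -
    obtain d where d: "0 < d" "ball x d \<subseteq> \<Omega>" using \<Omega>(1) x open_contains_ball by blast
    have "dist x (x - (d/2) *\<^sub>R \<nu>) = d / 2" using d(1) \<nu> by (simp add: dist_norm)
    then have "x - (d/2) *\<^sub>R \<nu> \<in> \<Omega>" using d by (intro subsetD[OF d(2)]) (simp add: mem_ball)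
    then have "a \<le> (x - (d/2) *\<^sub>R \<nu>) \<bullet> \<nu>" unfolding a_def by (intro cInf_lower bd) auto
    also have "\<dots> < x \<bullet> \<nu>" using d(1) \<nu> by (simp add: inner_diff_left norm_eq_1)
    finally show ?thesis .
  qed
  show "(\<integral>\<^sup>+x\<in>\<Omega>. ennreal ((\<phi> x)\<^sup>2 / (x \<bullet> \<nu> - a)\<^sup>2) \<partial>lborel)
      \<le> (\<integral>\<^sup>+x. ennreal (4 * (norm (gradient \<phi> x))\<^sup>2) \<partial>lborel)"
  proof (rule hardy_direction[OF \<phi> \<nu>])
    fix x assume "x \<in> \<Omega>"
    then show "0 < x \<bullet> \<nu> - a" using less by simp
    have "(x - (x \<bullet> \<nu> - a) *\<^sub>R \<nu>) \<bullet> \<nu> = a"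
      using \<nu> by (simp add: inner_diff_left norm_eq_1)
    then show "x - (x \<bullet> \<nu> - a) *\<^sub>R \<nu> \<notin> \<Omega>" using less[of "x - (x \<bullet> \<nu> - a) *\<^sub>R \<nu>"] by auto
  qed (use \<Omega>(1) \<nu> in \<open>auto simp: inner_add_left norm_eq_1\<close>)
qed

subsection \<open>Hardy's inequality on Lipschitz domains\<close>

text \<open>The 8 is the constant of dimension one, 4 for each endpoint, and makes the value
  positive for every \<open>M\<close> and \<open>N\<close>. The other summand is for higher
  dimensions: 4 from the half line times the chart contribution, (28 (M + 1))^2 for each cylinder,
  plus the interior contribution, the squared ratio of the width bound
  \<open>12 * N * (M + 1) * r\<close> to \<open>r / 4\<close>.\<close>

definition hardy_const :: "real \<Rightarrow> nat \<Rightarrow> real" where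
  "hardy_const M N = 8 + 4 * (real N * (28 * (M + 1))\<^sup>2 + 16 * (12 * real N * (M + 1))\<^sup>2)"

lemma nn_integral_weighted_le:
  fixes h k :: "'a::euclidean_space \<Rightarrow> real"
  assumes "(\<integral>\<^sup>+x\<in>S. ennreal (h x) \<partial>lborel) \<le> J" "h \<in> borel_measurable borel" "S \<in> sets borel"
  shows "(\<integral>\<^sup>+x. ennreal c * (ennreal (h x) * indicator S x) \<partial>lborel) \<le> ennreal c * J"
  using assms by (subst nn_integral_cmult) (auto intro: mult_left_mono)

lemma infdist_frontier_pos:
  assumes "open \<Omega>" "bounded \<Omega>" "(x :: 'a::euclidean_space) \<in> \<Omega>"
  shows "0 < infdist x (frontier \<Omega>)" "frontier \<Omega> \<noteq> {}"
proof -
  show "frontier \<Omega> \<noteq> {}"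
    using assms frontier_eq_empty[of \<Omega>] not_bounded_UNIV by auto
  moreover have "x \<notin> frontier \<Omega>" using assms(1,3) by (simp add: frontier_def interior_open)
  ultimately show "0 < infdist x (frontier \<Omega>)"
    by (metis frontier_closed in_closed_iff_infdist_zero infdist_nonneg order_le_less)
qed

lemma le_infdistI: "A \<noteq> {} \<Longrightarrow> (\<And>y. y \<in> A \<Longrightarrow> c \<le> dist x y) \<Longrightarrow> c \<le> infdist x A"
  unfolding infdist_notempty by (intro cINF_greatest)

text \<open>In dimension one a point is determined by its product with \<open>e\<close>, and a
  connected domain is the whole open interval between its extreme values. The distance to the
  frontier is thus at least the smaller of the distances to the two ends, and the slab inequalities
  for \<open>e\<close> and \<open>- e\<close> add up to 4 + 4.\<close>

lemma hardy_dim_one: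
  fixes \<Omega> :: "(real^'d::finite) set"
  assumes \<phi>: "test_fn \<Omega> \<phi>" and \<Omega>: "open \<Omega>" "bounded \<Omega>" "connected \<Omega>" and d: "CARD('d) = 1"
  shows "(\<integral>\<^sup>+x\<in>\<Omega>. ennreal ((\<phi> x)\<^sup>2 / (infdist x (frontier \<Omega>))\<^sup>2) \<partial>lborel)
    \<le> ennreal 8 * (\<integral>\<^sup>+x. ennreal ((norm (gradient \<phi> x))\<^sup>2) \<partial>lborel)"
proof -
  have "is_singleton (UNIV :: 'd set)" using d by (simp add: is_singleton_altdef)
  then obtain i where i: "(UNIV :: 'd set) = {i}" unfolding is_singleton_def by blast
  define e :: "real^'d" where "e = axis i 1"
  have e: "norm e = 1" "norm (- e) = 1" by (simp_all add: e_def)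
  have e_inj: "x = y" if "x \<bullet> e = y \<bullet> e" for x y :: "real^'d"
  proof -
    have "x $ i = y $ i" using that by (simp add: e_def inner_axis)
    moreover have "x $ i = y $ i \<longleftrightarrow> (\<forall>j\<in>UNIV. x $ j = y $ j)" unfolding i by blast
    ultimately show ?thesis unfolding vec_eq_iff by blast
  qed
  define a where "a \<nu> = Inf ((\<lambda>x. x \<bullet> \<nu>) ` \<Omega>)" for \<nu>
  let ?\<rho> = "\<lambda>x. infdist x (frontier \<Omega>)"
  have [measurable]: "\<phi> \<in> borel_measurable borel" "gradient \<phi> \<in> borel_measurable borel" "\<Omega> \<in> sets borel"
    using test_fn_smooth[OF \<phi>] \<Omega>(1)
    by (auto intro!: borel_measurable_continuous_onI smooth_continuous continuous_on_gradient)
  have slab: "a \<nu> < x \<bullet> \<nu>" if "x \<in> \<Omega>" "\<nu> = e \<or> \<nu> = - e" for x \<nu>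
    using hardy_slab(2)[OF \<phi> \<Omega>(1,2), of \<nu> x] e that by (auto simp: a_def)
  have dist_ge: "\<bar>x \<bullet> e - y \<bullet> e\<bar> \<le> dist x y" for x y
    using Cauchy_Schwarz_ineq2[of "x - y" e] by (simp add: e dist_norm inner_diff_left)
  have \<rho>: "x \<bullet> e - a e \<le> ?\<rho> x \<or> x \<bullet> (- e) - a (- e) \<le> ?\<rho> x" if x: "x \<in> \<Omega>" for x
  proof -
    have "min (x \<bullet> e - a e) (x \<bullet> (- e) - a (- e)) \<le> ?\<rho> x"
    proof (rule le_infdistI)
      show "frontier \<Omega> \<noteq> {}" using infdist_frontier_pos[OF \<Omega>(1,2) x] by simp
      fix y assume "y \<in> frontier \<Omega>"
      then have y: "y \<notin> \<Omega>" using \<Omega>(1) by (simp add: frontier_def interior_open)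
      \<comment> \<open>A frontier point strictly between the two ends would have domain points on
        both sides and so belong to the domain, which is open.\<close>
      have "\<not> (a e < y \<bullet> e \<and> a (- e) < y \<bullet> (- e))"
      proof
        assume "a e < y \<bullet> e \<and> a (- e) < y \<bullet> (- e)"
        then obtain p q where "p \<in> \<Omega>" "p \<bullet> e < y \<bullet> e" "q \<in> \<Omega>" "q \<bullet> (- e) < y \<bullet> (- e)"
          using cInf_lessD[of "(\<lambda>x. x \<bullet> e) ` \<Omega>" "y \<bullet> e"]
            cInf_lessD[of "(\<lambda>x. x \<bullet> (- e)) ` \<Omega>" "y \<bullet> (- e)"] x
          unfolding a_def by blast
        then obtain w where "w \<in> \<Omega>" "w \<bullet> e = y \<bullet> e"
          using connected_inner_between[OF \<Omega>(3), of p q e "y \<bullet> e"] by auto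
        then show False using y e_inj by blast
      qed
      then show "min (x \<bullet> e - a e) (x \<bullet> (- e) - a (- e)) \<le> dist x y"
        using dist_ge[of x y] by auto
    qed
    then show ?thesis by linarith
  qed
  let ?h = "\<lambda>\<nu> x. (\<phi> x)\<^sup>2 / (x \<bullet> \<nu> - a \<nu>)\<^sup>2"
  let ?J = "\<integral>\<^sup>+x. ennreal (4 * (norm (gradient \<phi> x))\<^sup>2) \<partial>lborel"
  have le: "ennreal ((\<phi> x)\<^sup>2 / (?\<rho> x)\<^sup>2) \<le> ennreal (?h e x) + ennreal (?h (- e) x)" if x: "x \<in> \<Omega>" for x
  proof -
    obtain \<nu> where \<nu>: "\<nu> = e \<or> \<nu> = - e" "x \<bullet> \<nu> - a \<nu> \<le> ?\<rho> x" using \<rho>[OF x] by blast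
    have "0 < x \<bullet> \<nu> - a \<nu>" using slab[OF x \<nu>(1)] by simp
    then have "(\<phi> x)\<^sup>2 / (?\<rho> x)\<^sup>2 \<le> ?h \<nu> x"
      using \<nu>(2) by (intro divide_left_mono power_mono mult_pos_pos zero_less_power) auto
    then have "ennreal ((\<phi> x)\<^sup>2 / (?\<rho> x)\<^sup>2) \<le> ennreal (?h \<nu> x)" by (rule ennreal_leI)
    also have "\<dots> \<le> ennreal (?h e x) + ennreal (?h (- e) x)"
      using \<nu>(1) by (auto intro: add_increasing add_increasing2)
    finally show ?thesis .
  qed
  have "(\<integral>\<^sup>+x\<in>\<Omega>. ennreal ((\<phi> x)\<^sup>2 / (?\<rho> x)\<^sup>2) \<partial>lborel)
      \<le> (\<integral>\<^sup>+x. ennreal (?h e x) * indicator \<Omega> x + ennreal (?h (- e) x) * indicator \<Omega> x \<partial>lborel)"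
    using le by (intro nn_integral_mono) (auto simp: indicator_def)
  also have "\<dots> = (\<integral>\<^sup>+x\<in>\<Omega>. ennreal (?h e x) \<partial>lborel) + (\<integral>\<^sup>+x\<in>\<Omega>. ennreal (?h (- e) x) \<partial>lborel)"
    by (intro nn_integral_add) measurable
  also have "\<dots> \<le> ?J + ?J"
    using hardy_slab(1)[OF \<phi> \<Omega>(1,2) e(1)] hardy_slab(1)[OF \<phi> \<Omega>(1,2) e(2)]
    by (intro add_mono) (simp_all add: a_def)
  also have "\<dots> = (\<integral>\<^sup>+x. ennreal 8 * ennreal ((norm (gradient \<phi> x))\<^sup>2) \<partial>lborel)"
  proof -
    have "ennreal (4 * t) + ennreal (4 * t) = ennreal 8 * ennreal t" if "0 \<le> t" for t
      using that by (simp add: ennreal_mult flip: distrib_right)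
    then show ?thesis by (subst nn_integral_add[symmetric]) auto
  qed
  also have "\<dots> = ennreal 8 * (\<integral>\<^sup>+x. ennreal ((norm (gradient \<phi> x))\<^sup>2) \<partial>lborel)"
    by (intro nn_integral_cmult) measurable
  finally show ?thesis .
qed

text \<open>Points closer than \<open>r / 4\<close> to the frontier lie in one of the enlarged
  half-size cylinders, where the chart height controls the distance. At the other points the
  distance is at least \<open>r / 4\<close>, and the slab inequality in a direction of width at most
  \<open>L\<close> takes over.\<close>

lemma hardy_higher_dim:
  fixes \<Omega> :: "(real^'d::finite) set"
  assumes \<phi>: "test_fn \<Omega> \<phi>" and char: "lipschitz_domain_char \<Omega> M N" and M: "0 \<le> M" and d: "CARD('d) \<noteq> 1"
  shows "(\<integral>\<^sup>+x\<in>\<Omega>. ennreal ((\<phi> x)\<^sup>2 / (infdist x (frontier \<Omega>))\<^sup>2) \<partial>lborel)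
    \<le> ennreal (real N * (28 * (M + 1))\<^sup>2 + 16 * (12 * real N * (M + 1))\<^sup>2)
      * (\<integral>\<^sup>+x. ennreal (4 * (norm (gradient \<phi> x))\<^sup>2) \<partial>lborel)"
proof -
  from char obtain r z \<nu> \<psi> where \<Omega>: "bounded \<Omega>" "open \<Omega>" "connected \<Omega>" "\<Omega> \<noteq> {}" and r: "0 < r"
    and \<nu>: "\<And>l. l < N \<Longrightarrow> norm (\<nu> l) = 1"
    and \<psi>: "\<And>l. l < N \<Longrightarrow> M-lipschitz_on {y. y \<bullet> \<nu> l = 0} (\<psi> l)" "\<And>l. l < N \<Longrightarrow> \<psi> l 0 = 0"
    and chart: "\<And>l. l < N \<Longrightarrow> \<Omega> \<inter> cyl (z l) (\<nu> l) r (10 * (M + 1) * r)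
      = {x \<in> cyl (z l) (\<nu> l) r (10 * (M + 1) * r). (x - z l) \<bullet> \<nu> l > \<psi> l (hproj (\<nu> l) (x - z l))}"
    and cover: "frontier \<Omega> \<subseteq> (\<Union>l<N. cyl (z l) (\<nu> l) (r / 2) (5 * (M + 1) * r))"
    unfolding lipschitz_domain_char_def by blast
  define \<rho> where "\<rho> x = infdist x (frontier \<Omega>)" for x
  have \<rho>_pos: "0 < \<rho> x" if "x \<in> \<Omega>" for x
    unfolding \<rho>_def by (rule infdist_frontier_pos[OF \<Omega>(2,1) that])
  have fr: "frontier \<Omega> \<noteq> {}" using infdist_frontier_pos[OF \<Omega>(2,1)] \<Omega>(4) by blast
  have [measurable]: "\<phi> \<in> borel_measurable borel" "gradient \<phi> \<in> borel_measurable borel" "\<Omega> \<in> sets borel"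
    using test_fn_smooth[OF \<phi>] \<Omega>(2)
    by (auto intro!: borel_measurable_continuous_onI smooth_continuous continuous_on_gradient)
  define J where "J = (\<integral>\<^sup>+x. ennreal (4 * (norm (gradient \<phi> x))\<^sup>2) \<partial>lborel)"
  define k where "k = 28 * (M + 1)"
  have k: "0 < k" using M by (simp add: k_def)

  define \<tau> where "\<tau> l x = (x - z l) \<bullet> \<nu> l - \<psi> l (hproj (\<nu> l) (x - z l))" for l x
  \<comment> \<open>The half-size cylinders that cover the frontier, enlarged by
    \<open>r / 4\<close>: 1/2 + 1/4 = 3/4 for the radius, and \<open>5 * (M + 1) * r + r / 4\<close>
    is at most \<open>6 * (M + 1) * r\<close> for the height.\<close>
  define S where "S l = \<Omega> \<inter> cyl (z l) (\<nu> l) (3/4 * r) (6 * (M + 1) * r)" for l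
  have S_meas: "S l \<in> sets borel" for l
  proof -
    have "open (cyl (z l) (\<nu> l) (3/4 * r) (6 * (M + 1) * r))"
      unfolding cyl_def
      by (intro open_Collect_conj open_Collect_less continuous_intros continuous_on_hproj)
    then show ?thesis using \<Omega>(2) by (auto simp: S_def)
  qed
  have \<tau>_meas: "\<tau> l \<in> borel_measurable borel" if "l < N" for l
    unfolding \<tau>_def[abs_def]
    by (intro borel_measurable_continuous_onI continuous_intros
        continuous_on_compose2[OF lipschitz_on_continuous_on[OF \<psi>(1)[OF that]] continuous_on_hproj])
      (auto simp: hproj_inner[OF \<nu>[OF that]])
  have near: "(\<integral>\<^sup>+x\<in>S l. ennreal ((\<phi> x)\<^sup>2 / (\<tau> l x)\<^sup>2) \<partial>lborel) \<le> J" if l: "l < N" for l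
    unfolding J_def
  proof (rule hardy_direction[OF \<phi> \<nu>[OF l] S_meas \<tau>_meas[OF l]])
    fix x :: "real^'d" and s :: real
    have "x + s *\<^sub>R \<nu> l - z l = (x - z l) + s *\<^sub>R \<nu> l" by simp
    then show "\<tau> l (x + s *\<^sub>R \<nu> l) = \<tau> l x + s"
      using \<nu>[OF l] by (simp only: \<tau>_def hproj_add_scaleR) (simp add: inner_add_left norm_eq_1)
  next
    fix x assume x: "x \<in> S l"
    then have x: "x \<in> \<Omega>" "x \<in> cyl (z l) (\<nu> l) (3/4 * r) (6 * (M + 1) * r)" by (auto simp: S_def)
    note lipschitz_graph_chart[OF \<Omega>(2) r M \<nu>[OF l] \<psi>[OF l] chart[OF l] x]
    then show "0 < \<tau> l x" "x - \<tau> l x *\<^sub>R \<nu> l \<notin> \<Omega>" unfolding \<tau>_def by blast+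
  qed
  have near_le: "(\<phi> x)\<^sup>2 / (\<rho> x)\<^sup>2 \<le> k\<^sup>2 * ((\<phi> x)\<^sup>2 / (\<tau> l x)\<^sup>2)" if l: "l < N" and "x \<in> S l" for x l
  proof -
    have x: "x \<in> \<Omega>" "x \<in> cyl (z l) (\<nu> l) (3/4 * r) (6 * (M + 1) * r)" using that(2) by (auto simp: S_def)
    note ch = lipschitz_graph_chart[OF \<Omega>(2) r M \<nu>[OF l] \<psi>[OF l] chart[OF l] x, folded \<tau>_def]
    have "\<tau> l x / k \<le> \<rho> x"
      unfolding \<rho>_def
    proof (rule le_infdistI[OF fr])
      fix y assume "y \<in> frontier \<Omega>"
      then show "\<tau> l x / k \<le> dist x y" using ch(3)[of y] k unfolding k_def[symmetric] by (simp add: field_simps)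
    qed
    then have "(\<phi> x)\<^sup>2 / (\<rho> x)\<^sup>2 \<le> (\<phi> x)\<^sup>2 / (\<tau> l x / k)\<^sup>2"
      using ch(1) k by (intro divide_left_mono power_mono mult_pos_pos zero_less_power \<rho>_pos x) auto
    then show ?thesis by (simp add: power_divide mult.commute)
  qed

  \<comment> \<open>The bound on the width needs a second direction orthogonal to \<open>e\<close>,
    which exists from dimension two on.\<close>
  have "\<not> (\<forall>i j :: 'd. i = j)"
  proof
    assume *: "\<forall>i j :: 'd. i = j"
    have "(UNIV :: 'd set) = {undefined}" using * by blast
    then have "CARD('d) = card {undefined :: 'd}" by (rule arg_cong)
    then show False using d by simp
  qed
  then obtain i j :: 'd where ij: "i \<noteq> j" by blast
  define e e' :: "real^'d" where "e = axis i 1" and "e' = axis j 1"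
  have e: "norm e = 1" "norm e' = 1" "e' \<bullet> e = 0"
    using ij by (simp_all add: e_def e'_def inner_axis_axis)
  \<comment> \<open>\<open>N\<close> balls of radius \<open>6 * (M + 1) * r\<close> cover the
    frontier, and each casts a shadow of length \<open>12 * (M + 1) * r\<close>.\<close>
  define L where "L = 12 * real N * (M + 1) * r"
  have "frontier \<Omega> \<subseteq> (\<Union>l<N. cball (z l) (6 * (M + 1) * r))"
  proof
    fix y assume "y \<in> frontier \<Omega>"
    then obtain l where l: "l < N" "y \<in> cyl (z l) (\<nu> l) (r / 2) (5 * (M + 1) * r)" using cover by auto
    have "dist y (z l) < r / 2 + 5 * (M + 1) * r" by (rule cyl_dist[OF \<nu>[OF l(1)] l(2)])
    also have "\<dots> \<le> 6 * (M + 1) * r" using M r by (simp add: algebra_simps)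
    finally show "y \<in> (\<Union>l<N. cball (z l) (6 * (M + 1) * r))"
      using l(1) by (auto simp: dist_commute intro!: bexI[of _ l])
  qed
  from width_le_of_frontier_cover[OF \<Omega>(1,3) this _ e]
  have "x \<bullet> e - y \<bullet> e \<le> real N * (2 * (6 * (M + 1) * r))" if "x \<in> \<Omega>" "y \<in> \<Omega>" for x y
    using that M r by simp
  moreover have "real N * (2 * (6 * (M + 1) * r)) = L" by (simp add: L_def algebra_simps)
  ultimately have width: "x \<bullet> e - y \<bullet> e \<le> L" if "x \<in> \<Omega>" "y \<in> \<Omega>" for x y
    using that by simp
  define a where "a = Inf ((\<lambda>x. x \<bullet> e) ` \<Omega>)"
  have a: "0 < x \<bullet> e - a" "x \<bullet> e - a \<le> L" if "x \<in> \<Omega>" for x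
  proof -
    show "0 < x \<bullet> e - a" using hardy_slab(2)[OF \<phi> \<Omega>(2,1) e(1) that] by (simp add: a_def)
    have "x \<bullet> e - L \<le> a"
      unfolding a_def using \<Omega>(4) width[OF that] by (intro cINF_greatest) (auto simp: algebra_simps)
    then show "x \<bullet> e - a \<le> L" by simp
  qed
  have far: "(\<integral>\<^sup>+x\<in>\<Omega>. ennreal ((\<phi> x)\<^sup>2 / (x \<bullet> e - a)\<^sup>2) \<partial>lborel) \<le> J"
    unfolding J_def a_def by (rule hardy_slab(1)[OF \<phi> \<Omega>(2,1) e(1)])
  \<comment> \<open>This is \<open>16 * L\<^sup>2 / r\<^sup>2\<close>, in which the cylinder size
    cancels.\<close>
  define c where "c = 16 * (12 * real N * (M + 1))\<^sup>2"
  have far_le: "(\<phi> x)\<^sup>2 / (\<rho> x)\<^sup>2 \<le> c * ((\<phi> x)\<^sup>2 / (x \<bullet> e - a)\<^sup>2)" if x: "x \<in> \<Omega>" and "r / 4 \<le> \<rho> x" for x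
  proof -
    have "(\<phi> x)\<^sup>2 / (\<rho> x)\<^sup>2 \<le> (\<phi> x)\<^sup>2 / (r / 4)\<^sup>2"
      using that r by (intro divide_left_mono power_mono mult_pos_pos zero_less_power) auto
    also have "\<dots> = (16 / r\<^sup>2) * (\<phi> x)\<^sup>2" by (simp add: power_divide)
    also have "\<dots> \<le> (16 / r\<^sup>2) * (L\<^sup>2 * ((\<phi> x)\<^sup>2 / (x \<bullet> e - a)\<^sup>2))"
    proof (rule mult_left_mono)
      have "(x \<bullet> e - a)\<^sup>2 * (\<phi> x)\<^sup>2 \<le> L\<^sup>2 * (\<phi> x)\<^sup>2"
        using a[OF x] by (intro mult_right_mono power_mono) auto
      then show "(\<phi> x)\<^sup>2 \<le> L\<^sup>2 * ((\<phi> x)\<^sup>2 / (x \<bullet> e - a)\<^sup>2)"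
        using a(1)[OF x] by (simp add: field_simps)
    qed simp
    also have "\<dots> = c * ((\<phi> x)\<^sup>2 / (x \<bullet> e - a)\<^sup>2)"
      using r by (simp add: L_def c_def power_mult_distrib)
    finally show ?thesis .
  qed

  \<comment> \<open>At each point one summand dominates and the others are nonnegative. No partition
    of unity is needed; overlapping cylinders cost only the factor \<open>N\<close>.\<close>
  let ?H = "\<lambda>x. (\<Sum>l<N. ennreal (k\<^sup>2) * (ennreal ((\<phi> x)\<^sup>2 / (\<tau> l x)\<^sup>2) * indicator (S l) x))
    + ennreal c * (ennreal ((\<phi> x)\<^sup>2 / (x \<bullet> e - a)\<^sup>2) * indicator \<Omega> x)"
  have pointwise: "ennreal ((\<phi> x)\<^sup>2 / (\<rho> x)\<^sup>2) \<le> ?H x" if x: "x \<in> \<Omega>" for x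
  proof (cases "r / 4 \<le> \<rho> x")
    case True
    have "ennreal ((\<phi> x)\<^sup>2 / (\<rho> x)\<^sup>2) \<le> ennreal (c * ((\<phi> x)\<^sup>2 / (x \<bullet> e - a)\<^sup>2))"
      using far_le[OF x True] by (rule ennreal_leI)
    also have "\<dots> = ennreal c * (ennreal ((\<phi> x)\<^sup>2 / (x \<bullet> e - a)\<^sup>2) * indicator \<Omega> x)"
      using x by (subst ennreal_mult) (auto simp: c_def)
    also have "\<dots> \<le> ?H x" by (intro add_increasing) auto
    finally show ?thesis .
  next
    case False
    obtain y where y: "y \<in> frontier \<Omega>" "\<rho> x = dist x y"
      unfolding \<rho>_def using infdist_attains_inf[OF frontier_closed fr] by metis
    then obtain l where l: "l < N" "y \<in> cyl (z l) (\<nu> l) (r / 2) (5 * (M + 1) * r)" using cover by auto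
    have "r / 4 \<le> (M + 1) * r" using M r by (simp add: distrib_right add_nonneg_nonneg add_increasing)
    then have "5 * (M + 1) * r + r / 4 \<le> 6 * (M + 1) * r" by (simp add: algebra_simps)
    then have "x \<in> cyl (z l) (\<nu> l) (3/4 * r) (6 * (M + 1) * r)"
      using False y(2) by (intro cyl_enlarge[OF \<nu>[OF l(1)] l(2), where e = "r / 4"]) auto
    then have xS: "x \<in> S l" using x by (simp add: S_def)
    have "ennreal ((\<phi> x)\<^sup>2 / (\<rho> x)\<^sup>2) \<le> ennreal (k\<^sup>2 * ((\<phi> x)\<^sup>2 / (\<tau> l x)\<^sup>2))"
      using near_le[OF l(1) xS] by (rule ennreal_leI)
    also have "\<dots> = ennreal (k\<^sup>2) * (ennreal ((\<phi> x)\<^sup>2 / (\<tau> l x)\<^sup>2) * indicator (S l) x)"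
      using xS by (subst ennreal_mult) auto
    also have "\<dots> \<le> (\<Sum>l<N. ennreal (k\<^sup>2) * (ennreal ((\<phi> x)\<^sup>2 / (\<tau> l x)\<^sup>2) * indicator (S l) x))"
      by (rule member_le_sum) (use l(1) in auto)
    also have "\<dots> \<le> ?H x" by simp
    finally show ?thesis .
  qed
  have "(\<integral>\<^sup>+x\<in>\<Omega>. ennreal ((\<phi> x)\<^sup>2 / (\<rho> x)\<^sup>2) \<partial>lborel) \<le> (\<integral>\<^sup>+x. ?H x \<partial>lborel)"
    using pointwise by (intro nn_integral_mono) (auto simp: indicator_def)
  also have "\<dots> = (\<Sum>l<N. \<integral>\<^sup>+x. ennreal (k\<^sup>2) * (ennreal ((\<phi> x)\<^sup>2 / (\<tau> l x)\<^sup>2) * indicator (S l) x) \<partial>lborel)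
    + (\<integral>\<^sup>+x. ennreal c * (ennreal ((\<phi> x)\<^sup>2 / (x \<bullet> e - a)\<^sup>2) * indicator \<Omega> x) \<partial>lborel)"
    using \<tau>_meas S_meas by (subst nn_integral_add) (auto intro!: borel_measurable_sum nn_integral_sum)
  also have "\<dots> \<le> (\<Sum>l<N. ennreal (k\<^sup>2) * J) + ennreal c * J"
    using \<tau>_meas S_meas by (intro add_mono sum_mono nn_integral_weighted_le near far) auto
  also have "\<dots> = ennreal (real N * k\<^sup>2 + c) * J"
    by (simp add: c_def distrib_right ennreal_mult ennreal_of_nat_eq_real_of_nat mult.assoc)
  finally show ?thesis unfolding \<rho>_def k_def c_def J_def .
qed

lemma hardy_lipschitz_domain:
  fixes \<Omega> :: "(real^'d::finite) set"
  assumes \<phi>: "test_fn \<Omega> \<phi>" and char: "lipschitz_domain_char \<Omega> M N" and M: "0 \<le> M"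
  shows "(\<integral>\<^sup>+x\<in>\<Omega>. ennreal ((\<phi> x)\<^sup>2 / (infdist x (frontier \<Omega>))\<^sup>2) \<partial>lborel)
    \<le> ennreal (hardy_const M N) * (\<integral>\<^sup>+x. ennreal ((norm (gradient \<phi> x))\<^sup>2) \<partial>lborel)"
    (is "?L \<le> _ * ?R")
proof (cases "CARD('d) = 1")
  case True
  have "?L \<le> ennreal 8 * ?R"
    using char by (intro hardy_dim_one[OF \<phi> _ _ _ True]) (auto simp: lipschitz_domain_char_def)
  also have "\<dots> \<le> ennreal (hardy_const M N) * ?R"
    by (intro mult_right_mono ennreal_leI) (auto simp: hardy_const_def)
  finally show ?thesis .
next
  case False
  let ?c = "real N * (28 * (M + 1))\<^sup>2 + 16 * (12 * real N * (M + 1))\<^sup>2"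
  have [measurable]: "gradient \<phi> \<in> borel_measurable borel"
    using test_fn_smooth[OF \<phi>] by (auto intro!: borel_measurable_continuous_onI continuous_on_gradient)
  have c: "0 \<le> ?c" by simp
  have "?L \<le> ennreal ?c * (\<integral>\<^sup>+x. ennreal (4 * (norm (gradient \<phi> x))\<^sup>2) \<partial>lborel)"
    by (rule hardy_higher_dim[OF \<phi> char M False])
  also have "\<dots> = ennreal ?c * (\<integral>\<^sup>+x. ennreal 4 * ennreal ((norm (gradient \<phi> x))\<^sup>2) \<partial>lborel)"
    by (simp only: ennreal_mult zero_le_power2 zero_le_numeral)
  also have "\<dots> = ennreal ?c * (ennreal 4 * ?R)"
    by (subst nn_integral_cmult) measurable
  also have "\<dots> = ennreal (?c * 4) * ?R"
    unfolding ennreal_mult[OF c zero_le_numeral] by (simp only: mult.assoc)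
  also have "\<dots> \<le> ennreal (hardy_const M N) * ?R"
    by (intro mult_right_mono ennreal_leI) (auto simp: hardy_const_def)
  finally show ?thesis .
qed

section \<open>Integrability on the domain and Hardy's inequality for Lebesgue integrals\<close>

lemma norm_vec_square: "(norm v)\<^sup>2 = (\<Sum>i\<in>UNIV. (norm (v $ i))\<^sup>2)" for v :: "'b::real_inner^'n::finite"
  by (simp add: power2_norm_eq_inner inner_vec_def)

lemma L2_lebesgue_on:
  assumes "\<Omega> \<in> sets lebesgue" "L2 \<Omega> g"
  shows "g \<in> borel_measurable (lebesgue_on \<Omega>)" "integrable (lebesgue_on \<Omega>) (\<lambda>x. (norm (g x))\<^sup>2)"
  using assms unfolding L2_def set_borel_measurable_def set_integrable_def
  by (simp_all add: borel_measurable_restrict_space_iff integrable_restrict_space)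

lemma set_integral_lebesgue_on:
  fixes g :: "'a::euclidean_space \<Rightarrow> real"
  shows "\<Omega> \<in> sets lebesgue \<Longrightarrow> (LINT x:\<Omega>|lebesgue. g x) = integral\<^sup>L (lebesgue_on \<Omega>) g"
  unfolding set_lebesgue_integral_def by (rule integral_restrict_space[symmetric]) simp

lemma continuous_measurable_lebesgue_on:
  fixes g :: "'a::euclidean_space \<Rightarrow> 'b::euclidean_space"
  assumes "continuous_on UNIV g"
  shows "g \<in> borel_measurable (lebesgue_on \<Omega>)"
  using assms by (intro measurable_restrict_space1 measurable_completion) (simp add: borel_measurable_continuous_onI)

lemma continuous_bounded_on_bounded:
  fixes g :: "'a::euclidean_space \<Rightarrow> 'b::euclidean_space"
  assumes "continuous_on UNIV g" "bounded \<Omega>"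
  obtains B where "0 \<le> B" "\<And>x. x \<in> \<Omega> \<Longrightarrow> norm (g x) \<le> B"
proof -
  have "compact (g ` closure \<Omega>)"
    using assms by (intro compact_continuous_image continuous_on_subset[OF assms(1)]) (auto simp: compact_closure)
  then have "bounded (g ` closure \<Omega>)" by (rule compact_imp_bounded)
  then obtain B where B: "\<And>x. x \<in> closure \<Omega> \<Longrightarrow> norm (g x) \<le> B" by (auto simp: bounded_iff)
  show thesis
  proof (rule that)
    show "0 \<le> \<bar>B\<bar>" by simp
    fix x assume "x \<in> \<Omega>"
    then show "norm (g x) \<le> \<bar>B\<bar>" using B[of x] closure_subset by force
  qed
qed

text \<open>A function continuous on the whole space is bounded on a bounded set. This is how the
  smoothed weight, continuous up to the frontier and beyond, is admissible for either sign of the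
  exponent.\<close>

lemma integrable_mult_continuous:
  fixes g h :: "'a::euclidean_space \<Rightarrow> real"
  assumes g: "continuous_on UNIV g" and \<Omega>: "bounded \<Omega>" and h: "integrable (lebesgue_on \<Omega>) h"
  shows "integrable (lebesgue_on \<Omega>) (\<lambda>x. g x * h x)"
proof -
  obtain B where B: "0 \<le> B" "\<And>x. x \<in> \<Omega> \<Longrightarrow> norm (g x) \<le> B"
    using continuous_bounded_on_bounded[OF g \<Omega>] by blast
  show ?thesis
  proof (rule Bochner_Integration.integrable_bound)
    show "integrable (lebesgue_on \<Omega>) (\<lambda>x. B * h x)" using h by simp
    show "(\<lambda>x. g x * h x) \<in> borel_measurable (lebesgue_on \<Omega>)"
      using continuous_measurable_lebesgue_on[OF g] h by (intro borel_measurable_times) auto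
    show "AE x in lebesgue_on \<Omega>. norm (g x * h x) \<le> norm (B * h x)"
      using B by (intro AE_I2) (auto simp: abs_mult intro!: mult_right_mono)
  qed
qed

lemma integrable_continuous_lebesgue_on:
  fixes g :: "'a::euclidean_space \<Rightarrow> real"
  assumes "continuous_on UNIV g" "bounded \<Omega>" "\<Omega> \<in> sets lebesgue"
  shows "integrable (lebesgue_on \<Omega>) g"
proof -
  interpret finite_measure "lebesgue_on \<Omega>"
    using assms(2,3) by (intro finite_measure_lebesgue_on bounded_set_imp_lmeasurable)
  show ?thesis using integrable_mult_continuous[OF assms(1,2), of "\<lambda>_. 1"] by simp
qed

lemma test_fn_mult:
  assumes \<phi>: "test_fn U \<phi>" and w: "smooth w"
  shows "test_fn U (\<lambda>x. \<phi> x * w x)"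
proof -
  have sub: "closure {x. \<phi> x * w x \<noteq> 0} \<subseteq> closure {x. \<phi> x \<noteq> 0}" by (intro closure_mono) auto
  have c: "compact (closure {x. \<phi> x \<noteq> 0})" using \<phi> by (simp add: test_fn_def)
  have "compact (closure {x. \<phi> x * w x \<noteq> 0})"
    using compact_Int_closed[OF c closed_closure[of "{x. \<phi> x * w x \<noteq> 0}"]] sub by (simp add: Int_absorb1)
  moreover have "smooth (\<lambda>x. \<phi> x * w x)" using test_fn_smooth[OF \<phi>] w by (rule smooth_mult)
  ultimately show ?thesis using sub \<phi> by (auto simp: test_fn_def smooth_def)
qed

text \<open>The support is closed and contained in \<open>U\<close>, so \<open>\<phi>\<close>
  vanishes in a whole neighbourhood of \<open>x\<close>.\<close>

lemma gradient_eq_0_outside: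
  assumes \<phi>: "test_fn U \<phi>" and x: "x \<notin> U"
  shows "gradient \<phi> x = 0"
proof -
  let ?C = "closure {x. \<phi> x \<noteq> 0}"
  have x: "x \<in> - ?C" using \<phi> x by (auto simp: test_fn_def)
  have zero: "0 = \<phi> y" if "y \<in> - ?C" for y using that closure_subset[of "{x. \<phi> x \<noteq> 0}"] by auto
  have "(\<phi> has_derivative (\<lambda>_. 0)) (at x)"
    by (rule has_derivative_transform_within_open[OF has_derivative_const[of 0] _ x zero]) (simp add: open_Compl)
  from partial_eqI[OF this] show ?thesis by (simp add: gradient_def vec_eq_iff)
qed

lemma gradient_mult:
  assumes "smooth f" "smooth g"
  shows "gradient (\<lambda>x. f x * g x) x = f x *\<^sub>R gradient g x + g x *\<^sub>R gradient f x"
  using partial_mult[OF assms[THEN smooth_differentiable]]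
  by (simp add: gradient_def vec_eq_iff mult.commute)

text \<open>The gradient vanishes off the domain, so integrating it over the whole space gives
  nothing new. The finite right side then yields integrability of the quotient, whose denominator
  tends to zero at the frontier.\<close>

lemma hardy_lebesgue_on:
  fixes \<Omega> :: "(real^'d::finite) set"
  assumes \<phi>: "test_fn \<Omega> \<phi>" and char: "lipschitz_domain_char \<Omega> M N" and M: "0 \<le> M"
  shows "integrable (lebesgue_on \<Omega>) (\<lambda>x. (\<phi> x)\<^sup>2 / (infdist x (frontier \<Omega>))\<^sup>2)" (is "integrable _ ?h")
    and "integral\<^sup>L (lebesgue_on \<Omega>) (\<lambda>x. (\<phi> x)\<^sup>2 / (infdist x (frontier \<Omega>))\<^sup>2)
      \<le> hardy_const M N * integral\<^sup>L (lebesgue_on \<Omega>) (\<lambda>x. (norm (gradient \<phi> x))\<^sup>2)"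
proof -
  let ?g = "\<lambda>x. (norm (gradient \<phi> x))\<^sup>2"
  have \<Omega>: "open \<Omega>" "bounded \<Omega>" using char by (auto simp: lipschitz_domain_char_def)
  then have [measurable]: "\<Omega> \<in> sets borel" and \<Omega>_leb: "\<Omega> \<in> sets lebesgue" by (auto simp: sets_completionI_sets)
  have H: "0 \<le> hardy_const M N" by (simp add: hardy_const_def)
  have [measurable]: "\<phi> \<in> borel_measurable borel" "gradient \<phi> \<in> borel_measurable borel"
    using test_fn_smooth[OF \<phi>]
    by (auto intro!: borel_measurable_continuous_onI smooth_continuous continuous_on_gradient)
  have [measurable]: "(\<lambda>x. infdist x (frontier \<Omega>)) \<in> borel_measurable borel"
    by (intro borel_measurable_continuous_onI continuous_intros)
  have m: "?h \<in> borel_measurable (lebesgue_on \<Omega>)"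
    by (intro measurable_restrict_space1 measurable_completion) measurable
  have g: "integrable (lebesgue_on \<Omega>) ?g"
    by (intro integrable_continuous_lebesgue_on continuous_intros continuous_on_gradient test_fn_smooth[OF \<phi>] \<Omega> \<Omega>_leb)
  have "(\<integral>\<^sup>+x. ennreal (?h x) \<partial>lebesgue_on \<Omega>) = (\<integral>\<^sup>+x\<in>\<Omega>. ennreal (?h x) \<partial>lborel)"
    using \<Omega>_leb by (subst nn_integral_restrict_space) (auto simp: nn_integral_completion)
  also have "\<dots> \<le> ennreal (hardy_const M N) * (\<integral>\<^sup>+x. ennreal (?g x) \<partial>lborel)"
    by (rule hardy_lipschitz_domain[OF \<phi> char M])
  also have "(\<integral>\<^sup>+x. ennreal (?g x) \<partial>lborel) = (\<integral>\<^sup>+x. ennreal (?g x) * indicator \<Omega> x \<partial>lborel)"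
    using gradient_eq_0_outside[OF \<phi>] by (intro nn_integral_cong) (auto simp: indicator_def)
  also have "\<dots> = (\<integral>\<^sup>+x. ennreal (?g x) \<partial>lebesgue_on \<Omega>)"
    using \<Omega>_leb by (subst nn_integral_restrict_space) (auto simp: nn_integral_completion)
  also have "\<dots> = ennreal (integral\<^sup>L (lebesgue_on \<Omega>) ?g)"
    using g by (intro nn_integral_eq_integral) auto
  also have "ennreal (hardy_const M N) * \<dots> = ennreal (hardy_const M N * integral\<^sup>L (lebesgue_on \<Omega>) ?g)"
    using H by (simp add: ennreal_mult)
  finally have le: "(\<integral>\<^sup>+x. ennreal (?h x) \<partial>lebesgue_on \<Omega>) \<le> ennreal (hardy_const M N * integral\<^sup>L (lebesgue_on \<Omega>) ?g)" .
  then have "(\<integral>\<^sup>+x. ennreal (?h x) \<partial>lebesgue_on \<Omega>) < \<infinity>"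
    by (simp add: le_less_trans[OF _ ennreal_less_top])
  then show int: "integrable (lebesgue_on \<Omega>) ?h"
    using m by (intro integrableI_nonneg) auto
  from nn_integral_eq_integral[OF this] le
  have "ennreal (integral\<^sup>L (lebesgue_on \<Omega>) ?h) \<le> ennreal (hardy_const M N * integral\<^sup>L (lebesgue_on \<Omega>) ?g)" by simp
  then show "integral\<^sup>L (lebesgue_on \<Omega>) ?h \<le> hardy_const M N * integral\<^sup>L (lebesgue_on \<Omega>) ?g"
    using H by (subst (asm) ennreal_le_iff) auto
qed

subsection \<open>The weighted energy estimate\<close>

text \<open>The flux \<open>A \<xi>\<close> as a matrix, so that the fourfold sums become inner
  products and the energy estimate can be carried out in an abstract inner product space.\<close>

definition coeff_apply :: "('x \<Rightarrow> 'm::finite \<Rightarrow> 'm \<Rightarrow> 'd::finite \<Rightarrow> 'd \<Rightarrow> real) \<Rightarrow> 'x \<Rightarrow> real^'d^'m \<Rightarrow> real^'d^'m" where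
  "coeff_apply A x \<xi> = (\<chi> \<alpha> i. \<Sum>\<beta>\<in>UNIV. \<Sum>j\<in>UNIV. A x \<alpha> \<beta> i j * \<xi> $ \<beta> $ j)"

lemma coeff_apply_inner:
  "coeff_apply A x \<xi> \<bullet> \<zeta>
    = (\<Sum>\<alpha>\<in>UNIV. \<Sum>\<beta>\<in>UNIV. \<Sum>i\<in>UNIV. \<Sum>j\<in>UNIV. A x \<alpha> \<beta> i j * \<xi> $ \<beta> $ j * \<zeta> $ \<alpha> $ i)"
  unfolding coeff_apply_def inner_vec_def
  by (simp add: sum_distrib_right) (intro sum.cong refl sum.swap)

lemma coeff_apply_add: "coeff_apply A x (\<xi> + \<zeta>) = coeff_apply A x \<xi> + coeff_apply A x \<zeta>"
  by (simp add: coeff_apply_def vec_eq_iff distrib_left sum.distrib)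

text \<open>The exceptional null set does not depend on \<open>\<xi>\<close>, so the bounds may be
  used at gradients that vary with \<open>x\<close>.\<close>

lemma ellipticD:
  assumes "elliptic \<mu> A"
  shows "AE x in lebesgue. \<forall>\<xi>. \<mu> * (norm \<xi>)\<^sup>2 \<le> coeff_apply A x \<xi> \<bullet> \<xi> \<and> norm (coeff_apply A x \<xi>) \<le> norm \<xi> / \<mu>"
proof -
  have "coeff_apply A x \<xi> \<bullet> \<xi>
    = (\<Sum>\<alpha>\<in>UNIV. \<Sum>\<beta>\<in>UNIV. \<Sum>i\<in>UNIV. \<Sum>j\<in>UNIV. A x \<alpha> \<beta> i j * \<xi> $ \<alpha> $ i * \<xi> $ \<beta> $ j)" for x \<xi>
    unfolding coeff_apply_inner by (intro sum.cong refl) (simp add: mult_ac)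
  then show ?thesis using assms unfolding elliptic_def coeff_apply_def by simp
qed

lemma young:
  assumes "0 < (\<mu>::real)" shows "a * b \<le> \<mu> / 8 * a\<^sup>2 + 2 / \<mu> * b\<^sup>2"
proof -
  have "0 \<le> \<mu> / 8 * (a - 4 * b / \<mu>)\<^sup>2" using assms by simp
  also have "\<dots> = \<mu> / 8 * a\<^sup>2 + 2 / \<mu> * b\<^sup>2 - a * b"
    using assms by (simp add: power2_eq_square field_simps)
  finally show ?thesis by simp
qed

text \<open>Here \<open>G\<close> is the gradient of the approximation, \<open>E\<close> the error
  with \<open>Du = G + E\<close>, \<open>S\<close> and \<open>T\<close> are the fluxes of
  \<open>G\<close> and \<open>E\<close>, and \<open>P\<close> is the gradient of the test field. The
  bracket on the right integrates to zero by the equation, while ellipticity is applied to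
  \<open>G\<close> alone.\<close>

lemma energy_pointwise:
  fixes G H E F S T :: "'a::real_inner"
  assumes \<mu>: "0 < \<mu>" and w: "0 \<le> w" and SG: "\<mu> * (norm G)\<^sup>2 \<le> S \<bullet> G"
    and S: "norm S \<le> norm G / \<mu>" and T: "norm T \<le> norm E / \<mu>"
  defines "P \<equiv> (w * w) *\<^sub>R G + w *\<^sub>R H"
  shows "5 * \<mu> / 8 * (w\<^sup>2 * (norm G)\<^sup>2) \<le> ((S + T) \<bullet> P + F \<bullet> P)
    + (\<mu> / 4 + 2 / \<mu> ^ 3) * (norm H)\<^sup>2 + 4 / \<mu> * (w\<^sup>2 * (norm F)\<^sup>2) + 4 / \<mu> ^ 3 * (w\<^sup>2 * (norm E)\<^sup>2)"
proof -
  define g h a b where "g = w * norm G" and "h = norm H" and "a = w * norm F" and "b = w * norm E / \<mu>"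
  define c where "c = 2 / \<mu>"
  have P: "norm P \<le> w * (g + h)"
  proof -
    have "norm P \<le> norm ((w * w) *\<^sub>R G) + norm (w *\<^sub>R H)"
      unfolding P_def by (rule norm_triangle_ineq)
    then show ?thesis using w by (simp add: g_def h_def algebra_simps)
  qed
  have SP: "S \<bullet> P \<ge> \<mu> * g\<^sup>2 - g * (h / \<mu>)"
  proof -
    have "S \<bullet> H \<ge> - (norm S * norm H)" using Cauchy_Schwarz_ineq2[of S H] by linarith
    moreover have "norm S * norm H \<le> norm G / \<mu> * norm H" using S by (intro mult_right_mono) auto
    ultimately have "S \<bullet> H \<ge> - (norm G / \<mu> * norm H)" by linarith
    then have "w * (S \<bullet> H) \<ge> w * - (norm G / \<mu> * norm H)" using w by (intro mult_left_mono)
    moreover have "(w * w) * (S \<bullet> G) \<ge> (w * w) * (\<mu> * (norm G)\<^sup>2)" using SG w by (intro mult_left_mono) auto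
    ultimately show ?thesis
      by (simp add: P_def inner_add_right g_def h_def power2_eq_square algebra_simps)
  qed
  have TP: "T \<bullet> P \<ge> - (b * (g + h))"
  proof -
    have "norm T * norm P \<le> (norm E / \<mu>) * (w * (g + h))"
      using T P \<mu> by (intro mult_mono) auto
    then show ?thesis using Cauchy_Schwarz_ineq2[of T P] by (simp add: b_def mult_ac)
  qed
  have FP: "F \<bullet> P \<ge> - (a * (g + h))"
  proof -
    have "norm F * norm P \<le> norm F * (w * (g + h))" using P by (intro mult_left_mono) auto
    then show ?thesis using Cauchy_Schwarz_ineq2[of F P] by (simp add: a_def mult_ac)
  qed
  have "(S + T) \<bullet> P + F \<bullet> P \<ge> \<mu> * g\<^sup>2 - g * (h / \<mu>) - (g * a + h * a) - (g * b + h * b)"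
    using SP TP FP by (simp add: inner_add_left algebra_simps)
  moreover have y: "x * y \<le> \<mu> / 8 * x\<^sup>2 + c * y\<^sup>2" for x y
    unfolding c_def by (rule young[OF \<mu>])
  \<comment> \<open>Of the five products, three contain \<open>g\<close>, leaving 1 - 3/8 = 5/8 of
    the elliptic term, and two pair \<open>h\<close> with \<open>a\<close> or \<open>b\<close>,
    giving \<open>\<mu> / 4\<close>. The quantities \<open>a\<close> and \<open>b\<close> each occur
    twice and \<open>h / \<mu>\<close> once.\<close>
  ultimately have "5 * \<mu> / 8 * g\<^sup>2 \<le> ((S + T) \<bullet> P + F \<bullet> P)
      + (\<mu> / 4 * h\<^sup>2 + c * (h / \<mu>)\<^sup>2) + 2 * (c * a\<^sup>2) + 2 * (c * b\<^sup>2)"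
    using y[of g "h / \<mu>"] y[of g a] y[of h a] y[of g b] y[of h b] by linarith
  moreover have "c * (h / \<mu>)\<^sup>2 = 2 / \<mu> ^ 3 * h\<^sup>2" "2 * (c * a\<^sup>2) = 4 / \<mu> * (w\<^sup>2 * (norm F)\<^sup>2)"
    "2 * (c * b\<^sup>2) = 4 / \<mu> ^ 3 * (w\<^sup>2 * (norm E)\<^sup>2)"
    by (simp_all add: a_def b_def c_def power_divide power_mult_distrib power3_eq_cube power2_eq_square mult_ac)
  ultimately show ?thesis
    by (simp add: g_def h_def power_mult_distrib distrib_right)
qed

lemma norm_add_square_le: "(norm (a + b))\<^sup>2 \<le> 2 * (norm a)\<^sup>2 + 2 * (norm b)\<^sup>2"
  for a b :: "'a::real_inner"
proof -
  have "(norm (a + b))\<^sup>2 + (norm (a - b))\<^sup>2 = 2 * (norm a)\<^sup>2 + 2 * (norm b)\<^sup>2"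
    by (simp add: power2_norm_eq_inner inner_simps)
  moreover have "0 \<le> (norm (a - b))\<^sup>2" by simp
  ultimately show ?thesis by linarith
qed

lemma cgrad_nth: "cgrad \<phi> x $ \<alpha> = gradient (\<lambda>y. \<phi> y $ \<alpha>) x"
  by (simp add: cgrad_def gradient_def)

lemma continuous_on_cgrad:
  assumes "vtest_fn U \<phi>" shows "continuous_on S (cgrad \<phi>)"
proof -
  have "cgrad \<phi> = (\<lambda>x. \<chi> \<alpha>. gradient (\<lambda>y. \<phi> y $ \<alpha>) x)"
    by (simp add: fun_eq_iff vec_eq_iff cgrad_def gradient_def)
  then show ?thesis
    using assms by (auto simp: vtest_fn_def intro!: continuous_on_vec_lambda continuous_on_gradient test_fn_smooth[of U])
qed

text \<open>Hardy's inequality for \<open>w \<phi>\<close>, with the term containing \<open>\<nabla>w\<close> absorbed; \<open>H\<close> is the part of the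
  gradient of \<open>w\<^sup>2 \<phi>\<close> coming from the weight, divided by \<open>w\<close>.\<close>

lemma weight_gradient_absorb:
  fixes \<Omega> :: "(real^'d::finite) set" and \<phi> :: "real^'d \<Rightarrow> real^'m::finite"
  assumes char: "lipschitz_domain_char \<Omega> M N" and M: "0 \<le> M"
    and \<phi>: "vtest_fn \<Omega> \<phi>" and w: "smooth w"
    and gw: "\<And>x. x \<in> \<Omega> \<Longrightarrow> norm (gradient w x) * infdist x (frontier \<Omega>) \<le> s * \<bar>w x\<bar>"
    and s: "4 * hardy_const M N * s\<^sup>2 \<le> 1"
  defines "H \<equiv> \<lambda>x. \<chi> \<alpha>. (2 * \<phi> x $ \<alpha>) *\<^sub>R gradient w x"
  shows "integral\<^sup>L (lebesgue_on \<Omega>) (\<lambda>x. (norm (H x))\<^sup>2)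
    \<le> 16 * s\<^sup>2 * hardy_const M N * integral\<^sup>L (lebesgue_on \<Omega>) (\<lambda>x. (w x)\<^sup>2 * (norm (cgrad \<phi> x))\<^sup>2)"
proof -
  let ?C = "hardy_const M N" and ?\<rho> = "\<lambda>x. infdist x (frontier \<Omega>)"
  let ?I = "integral\<^sup>L (lebesgue_on \<Omega>)"
  have C: "0 \<le> ?C" by (simp add: hardy_const_def)
  have \<Omega>: "open \<Omega>" "bounded \<Omega>" "\<Omega> \<in> sets lebesgue"
    using char by (auto simp: lipschitz_domain_char_def sets_completionI_sets)
  have t: "test_fn \<Omega> (\<lambda>x. \<phi> x $ \<alpha>)" for \<alpha> using \<phi> by (simp add: vtest_fn_def)
  note sm = test_fn_smooth[OF t]
  let ?\<psi> = "\<lambda>\<alpha> x. \<phi> x $ \<alpha> * w x"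
  have t\<psi>: "test_fn \<Omega> (?\<psi> \<alpha>)" for \<alpha> by (rule test_fn_mult[OF t w])
  have cont: "continuous_on UNIV (\<lambda>x. \<phi> x $ \<alpha>)" "continuous_on UNIV w" "continuous_on UNIV (gradient w)"
    "continuous_on UNIV (gradient (?\<psi> \<alpha>))" for \<alpha>
    by (intro smooth_continuous continuous_on_gradient sm w test_fn_smooth[OF t\<psi>])+
  have contH: "continuous_on UNIV H" unfolding H_def
    by (intro continuous_intros cont)
  have normH: "(norm (H x))\<^sup>2 = (\<Sum>\<alpha>\<in>UNIV. 4 * (\<phi> x $ \<alpha>)\<^sup>2 * (norm (gradient w x))\<^sup>2)" for x
    unfolding norm_vec_square[of "H x"] by (simp add: H_def power_mult_distrib)
  have int_h: "integrable (lebesgue_on \<Omega>) (\<lambda>x. (norm (H x))\<^sup>2)"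
    by (intro integrable_continuous_lebesgue_on continuous_intros contH \<Omega>)
  have int_g: "integrable (lebesgue_on \<Omega>) (\<lambda>x. (w x)\<^sup>2 * (norm (cgrad \<phi> x))\<^sup>2)"
    by (intro integrable_continuous_lebesgue_on continuous_intros cont continuous_on_cgrad[OF \<phi>] \<Omega>)
  have int_\<psi>: "integrable (lebesgue_on \<Omega>) (\<lambda>x. (norm (gradient (?\<psi> \<alpha>) x))\<^sup>2)" for \<alpha>
    by (intro integrable_continuous_lebesgue_on continuous_intros cont \<Omega>)
  let ?X = "?I (\<lambda>x. (w x)\<^sup>2 * (norm (cgrad \<phi> x))\<^sup>2)" and ?H = "?I (\<lambda>x. (norm (H x))\<^sup>2)"
  have "?H \<le> ?I (\<lambda>x. 4 * s\<^sup>2 * (\<Sum>\<alpha>\<in>UNIV. (?\<psi> \<alpha> x)\<^sup>2 / (?\<rho> x)\<^sup>2))"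
  proof (rule integral_mono)
    show "integrable (lebesgue_on \<Omega>) (\<lambda>x. 4 * s\<^sup>2 * (\<Sum>\<alpha>\<in>UNIV. (?\<psi> \<alpha> x)\<^sup>2 / (?\<rho> x)\<^sup>2))"
      by (intro integrable_mult_right Bochner_Integration.integrable_sum hardy_lebesgue_on(1)[OF t\<psi> char M])
    fix x assume "x \<in> space (lebesgue_on \<Omega>)"
    then have x: "x \<in> \<Omega>" by simp
    have \<rho>: "0 < ?\<rho> x" by (rule infdist_frontier_pos(1)[OF \<Omega>(1,2) x])
    have "(norm (gradient w x) * ?\<rho> x)\<^sup>2 \<le> (s * \<bar>w x\<bar>)\<^sup>2"
      using gw[OF x] \<rho> by (intro power_mono) auto
    then have gw2: "(norm (gradient w x))\<^sup>2 \<le> s\<^sup>2 * (w x)\<^sup>2 / (?\<rho> x)\<^sup>2"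
      using \<rho> by (simp add: power_mult_distrib pos_le_divide_eq)
    have "(norm (H x))\<^sup>2 \<le> (\<Sum>\<alpha>\<in>UNIV. 4 * (\<phi> x $ \<alpha>)\<^sup>2 * (s\<^sup>2 * (w x)\<^sup>2 / (?\<rho> x)\<^sup>2))"
      unfolding normH by (intro sum_mono mult_left_mono gw2) auto
    also have "\<dots> = 4 * s\<^sup>2 * (\<Sum>\<alpha>\<in>UNIV. (?\<psi> \<alpha> x)\<^sup>2 / (?\<rho> x)\<^sup>2)"
      by (simp add: sum_distrib_left power_mult_distrib mult_ac)
    finally show "(norm (H x))\<^sup>2 \<le> 4 * s\<^sup>2 * (\<Sum>\<alpha>\<in>UNIV. (?\<psi> \<alpha> x)\<^sup>2 / (?\<rho> x)\<^sup>2)" .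
  qed (rule int_h)
  also have "\<dots> = 4 * s\<^sup>2 * (\<Sum>\<alpha>\<in>UNIV. ?I (\<lambda>x. (?\<psi> \<alpha> x)\<^sup>2 / (?\<rho> x)\<^sup>2))"
    using hardy_lebesgue_on(1)[OF t\<psi> char M] by (simp only: integral_mult_right_zero Bochner_Integration.integral_sum)
  also have "\<dots> \<le> 4 * s\<^sup>2 * (\<Sum>\<alpha>\<in>UNIV. ?C * ?I (\<lambda>x. (norm (gradient (?\<psi> \<alpha>) x))\<^sup>2))"
    by (intro mult_left_mono sum_mono hardy_lebesgue_on(2)[OF t\<psi> char M]) simp
  also have "\<dots> = 4 * s\<^sup>2 * ?C * ?I (\<lambda>x. \<Sum>\<alpha>\<in>UNIV. (norm (gradient (?\<psi> \<alpha>) x))\<^sup>2)"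
    by (subst Bochner_Integration.integral_sum[OF int_\<psi>]) (simp add: sum_distrib_left mult_ac)
  \<comment> \<open>The product rule splits the gradient of \<open>\<phi> w\<close> in two. The part
    with the gradient of \<open>w\<close> is half of \<open>|H|^2\<close>, because \<open>H\<close>
    carries a factor 2.\<close>
  also have "\<dots> \<le> 4 * s\<^sup>2 * ?C * ?I (\<lambda>x. 2 * ((w x)\<^sup>2 * (norm (cgrad \<phi> x))\<^sup>2) + (norm (H x))\<^sup>2 / 2)"
  proof (rule mult_left_mono[OF integral_mono])
    show "integrable (lebesgue_on \<Omega>) (\<lambda>x. \<Sum>\<alpha>\<in>UNIV. (norm (gradient (?\<psi> \<alpha>) x))\<^sup>2)"
      by (intro Bochner_Integration.integrable_sum int_\<psi>)
    show "integrable (lebesgue_on \<Omega>) (\<lambda>x. 2 * ((w x)\<^sup>2 * (norm (cgrad \<phi> x))\<^sup>2) + (norm (H x))\<^sup>2 / 2)"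
      using int_g int_h by simp
    show "0 \<le> 4 * s\<^sup>2 * ?C" using C by simp
    fix x
    have "(\<Sum>\<alpha>\<in>UNIV. (norm (gradient (?\<psi> \<alpha>) x))\<^sup>2)
      \<le> (\<Sum>\<alpha>\<in>UNIV. 2 * ((\<phi> x $ \<alpha>)\<^sup>2 * (norm (gradient w x))\<^sup>2) + 2 * ((w x)\<^sup>2 * (norm (gradient (\<lambda>y. \<phi> y $ \<alpha>) x))\<^sup>2))"
      unfolding gradient_mult[OF sm w]
      by (intro sum_mono order_trans[OF norm_add_square_le]) (simp add: power_mult_distrib)
    also have "\<dots> = 2 * ((w x)\<^sup>2 * (norm (cgrad \<phi> x))\<^sup>2) + (norm (H x))\<^sup>2 / 2"
      unfolding normH norm_vec_square[of "cgrad \<phi> x"] cgrad_nth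
      by (simp add: sum.distrib sum_distrib_left sum_divide_distrib)
    finally show "(\<Sum>\<alpha>\<in>UNIV. (norm (gradient (?\<psi> \<alpha>) x))\<^sup>2) \<le> 2 * ((w x)\<^sup>2 * (norm (cgrad \<phi> x))\<^sup>2) + (norm (H x))\<^sup>2 / 2" .
  qed
  also have "\<dots> = 4 * s\<^sup>2 * ?C * (2 * ?X + ?H / 2)"
    using int_g int_h by simp
  also have "\<dots> = 8 * s\<^sup>2 * ?C * ?X + (4 * ?C * s\<^sup>2) * (?H / 2)" by (simp add: algebra_simps)
  \<comment> \<open>The condition on \<open>s\<close> leaves at most half of the integral of
    \<open>|H|^2\<close> on the right. That integral is finite, \<open>H\<close> being continuous
    and the domain bounded, so it can be absorbed; this doubles 8 to 16.\<close>
  also have "\<dots> \<le> 8 * s\<^sup>2 * ?C * ?X + 1 * (?H / 2)"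
    by (intro add_left_mono mult_right_mono s) simp
  finally show ?thesis by simp
qed

section \<open>The energy estimate for a single test field\<close>

lemma mult_le_sum_squares:
  assumes "0 \<le> a" "0 \<le> (b::real)" shows "a * b \<le> a\<^sup>2 + b\<^sup>2"
proof -
  have "2 * (a * b) \<le> a\<^sup>2 + b\<^sup>2" using sum_squares_bound[of a b] by (simp add: mult.assoc)
  moreover have "0 \<le> a * b" using assms by simp
  ultimately show ?thesis by linarith
qed

lemma integrable_inner_of_squares:
  fixes f g :: "'a \<Rightarrow> 'b::euclidean_space"
  assumes "f \<in> borel_measurable N" "g \<in> borel_measurable N"
    and "integrable N (\<lambda>x. (norm (f x))\<^sup>2)" "integrable N (\<lambda>x. (norm (g x))\<^sup>2)"
  shows "integrable N (\<lambda>x. f x \<bullet> g x)"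
proof (rule Bochner_Integration.integrable_bound)
  show "integrable N (\<lambda>x. (norm (f x))\<^sup>2 + (norm (g x))\<^sup>2)" using assms by simp
  show "(\<lambda>x. f x \<bullet> g x) \<in> borel_measurable N" using assms by (intro borel_measurable_inner)
  have "\<bar>f x \<bullet> g x\<bar> \<le> (norm (f x))\<^sup>2 + (norm (g x))\<^sup>2" for x
  proof -
    have "norm (f x) * norm (g x) \<le> (norm (f x))\<^sup>2 + (norm (g x))\<^sup>2"
      by (rule mult_le_sum_squares) simp_all
    then show ?thesis using Cauchy_Schwarz_ineq2[of "f x" "g x"] by linarith
  qed
  then show "AE x in N. norm (f x \<bullet> g x) \<le> norm ((norm (f x))\<^sup>2 + (norm (g x))\<^sup>2)"
    by (intro AE_I2) simp
qed

lemma norm_diff_square_le: "(norm (a - b))\<^sup>2 \<le> 2 * (norm a)\<^sup>2 + 2 * (norm b)\<^sup>2"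
  for a b :: "'a::real_inner"
  using norm_add_square_le[of a "- b"] by simp

lemma weak_solution_inner:
  assumes "\<Omega> \<in> sets lebesgue" "weak_solution \<Omega> A Du f" "vtest_fn \<Omega> \<phi>"
  shows "(LINT x|lebesgue_on \<Omega>. coeff_apply A x (Du x) \<bullet> cgrad \<phi> x) = - (LINT x|lebesgue_on \<Omega>. f x \<bullet> cgrad \<phi> x)"
proof -
  have "f x \<bullet> cgrad \<phi> x = (\<Sum>\<alpha>\<in>UNIV. \<Sum>i\<in>UNIV. f x $ \<alpha> $ i * cgrad \<phi> x $ \<alpha> $ i)" for x
    by (simp add: inner_vec_def)
  then show ?thesis
    using assms(2)[unfolded weak_solution_def, rule_format, OF assms(3)]
    unfolding set_integral_lebesgue_on[OF assms(1)] coeff_apply_inner by simp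
qed

text \<open>The integrated form of the pointwise estimate for an arbitrary test field
  \<open>\<phi>\<close>, which need not be close to \<open>u\<close>: how far its gradient is from
  \<open>Du\<close> is recorded by the last term.\<close>

lemma weighted_energy_test:
  fixes \<Omega> :: "(real^'d::finite) set" and \<phi> :: "real^'d \<Rightarrow> real^'m::finite"
  assumes char: "lipschitz_domain_char \<Omega> M N" and M: "0 \<le> M"
    and \<mu>: "0 < \<mu>" and A: "elliptic \<mu> A" and Du: "L2 \<Omega> Du" and f: "L2 \<Omega> f"
    and weak: "weak_solution \<Omega> A Du f" and \<phi>: "vtest_fn \<Omega> \<phi>"
    and w: "smooth w" "\<And>x. 0 \<le> w x"
    and gw: "\<And>x. x \<in> \<Omega> \<Longrightarrow> norm (gradient w x) * infdist x (frontier \<Omega>) \<le> s * w x"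
    and s: "4 * hardy_const M N * s\<^sup>2 \<le> 1" "(\<mu> / 4 + 2 / \<mu> ^ 3) * (16 * s\<^sup>2 * hardy_const M N) \<le> \<mu> / 8"
  shows "(LINT x|lebesgue_on \<Omega>. (w x)\<^sup>2 * (norm (Du x))\<^sup>2)
    \<le> 16 / \<mu>\<^sup>2 * (LINT x|lebesgue_on \<Omega>. (w x)\<^sup>2 * (norm (f x))\<^sup>2)
      + (16 / \<mu> ^ 4 + 2) * (LINT x|lebesgue_on \<Omega>. (w x)\<^sup>2 * (norm (Du x - cgrad \<phi> x))\<^sup>2)"
proof -
  let ?L = "lebesgue_on \<Omega>"
  have \<Omega>: "open \<Omega>" "bounded \<Omega>" "\<Omega> \<in> sets lebesgue"
    using char by (auto simp: lipschitz_domain_char_def sets_completionI_sets)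
  note Du_L = L2_lebesgue_on[OF \<Omega>(3) Du] and f_L = L2_lebesgue_on[OF \<Omega>(3) f]
  have t: "test_fn \<Omega> (\<lambda>x. \<phi> x $ \<alpha>)" for \<alpha> using \<phi> by (simp add: vtest_fn_def)
  note sm = test_fn_smooth[OF t]
  define G H E where "G = cgrad \<phi>" and "H x = (\<chi> \<alpha>. (2 * \<phi> x $ \<alpha>) *\<^sub>R gradient w x)"
    and "E x = Du x - cgrad \<phi> x" for x
  define \<Phi> where "\<Phi> x = (\<chi> \<alpha>. \<phi> x $ \<alpha> * (w x * w x))" for x
  have ww: "smooth (\<lambda>x. w x * w x)" by (intro smooth_mult w)
  have v\<Phi>: "vtest_fn \<Omega> \<Phi>"
    using test_fn_mult[OF t ww] by (simp add: vtest_fn_def \<Phi>_def)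
  have P: "cgrad \<Phi> x = (w x * w x) *\<^sub>R G x + w x *\<^sub>R H x" for x
  proof (subst vec_eq_iff, rule allI)
    fix \<alpha>
    have "cgrad \<Phi> x $ \<alpha> = gradient (\<lambda>y. \<phi> y $ \<alpha> * (w y * w y)) x"
      by (simp add: cgrad_nth \<Phi>_def)
    also have "\<dots> = \<phi> x $ \<alpha> *\<^sub>R (w x *\<^sub>R gradient w x + w x *\<^sub>R gradient w x)
        + (w x * w x) *\<^sub>R gradient (\<lambda>y. \<phi> y $ \<alpha>) x"
      unfolding gradient_mult[OF sm ww] gradient_mult[OF w(1) w(1)] ..
    also have "\<dots> = ((w x * w x) *\<^sub>R G x + w x *\<^sub>R H x) $ \<alpha>"
      by (simp add: G_def H_def cgrad_nth algebra_simps flip: scaleR_2)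
    finally show "cgrad \<Phi> x $ \<alpha> = ((w x * w x) *\<^sub>R G x + w x *\<^sub>R H x) $ \<alpha>" .
  qed
  have contw: "continuous_on UNIV w" "continuous_on UNIV (gradient w)"
    and contG: "continuous_on UNIV G" and contP: "continuous_on UNIV (cgrad \<Phi>)"
    unfolding G_def
    by (intro smooth_continuous continuous_on_gradient w continuous_on_cgrad[OF \<phi>] continuous_on_cgrad[OF v\<Phi>])+
  have contH: "continuous_on UNIV H" unfolding H_def
    by (intro continuous_intros contw smooth_continuous sm)
  note int_cont = integrable_continuous_lebesgue_on[OF _ \<Omega>(2,3)]
  note [measurable] = Du_L(1) f_L(1) continuous_measurable_lebesgue_on[OF contG, of \<Omega>]
    continuous_measurable_lebesgue_on[OF contP, of \<Omega>] continuous_measurable_lebesgue_on[OF contw(1), of \<Omega>]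
  have [measurable]: "E \<in> borel_measurable ?L" unfolding E_def G_def[symmetric] by measurable
  have [measurable]: "(\<lambda>x. A x \<alpha> \<beta> i j) \<in> borel_measurable ?L" for \<alpha> \<beta> i j
    using A by (intro measurable_restrict_space1) (simp add: elliptic_def)
  have [measurable]: "(\<lambda>x. v x $ \<beta> $ j) \<in> borel_measurable ?L"
    if "v \<in> borel_measurable ?L" for v :: "real^'d \<Rightarrow> real^'d^'m" and \<beta> j
    using that by (rule borel_measurable_continuous_on[rotated]) (intro continuous_intros)
  have A': "AE x in ?L. \<forall>\<xi>. \<mu> * (norm \<xi>)\<^sup>2 \<le> coeff_apply A x \<xi> \<bullet> \<xi> \<and> norm (coeff_apply A x \<xi>) \<le> norm \<xi> / \<mu>"
    using ellipticD[OF A] \<Omega>(3) by (subst AE_restrict_space_iff) (auto elim: eventually_mono)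

  have w2: "continuous_on UNIV (\<lambda>x. (w x)\<^sup>2)" by (intro continuous_intros contw)
  note int_w = integrable_mult_continuous[OF w2 \<Omega>(2)]
  have int_G: "integrable ?L (\<lambda>x. (norm (G x))\<^sup>2)" and int_H: "integrable ?L (\<lambda>x. (norm (H x))\<^sup>2)"
    and int_P: "integrable ?L (\<lambda>x. (norm (cgrad \<Phi> x))\<^sup>2)"
    by (intro int_cont continuous_intros contG contH contP)+
  have int_E: "integrable ?L (\<lambda>x. (norm (E x))\<^sup>2)"
  proof (rule Bochner_Integration.integrable_bound)
    show "integrable ?L (\<lambda>x. 2 * (norm (Du x))\<^sup>2 + 2 * (norm (G x))\<^sup>2)"
      using Du_L(2) int_G by simp
    show "AE x in ?L. norm ((norm (E x))\<^sup>2) \<le> norm (2 * (norm (Du x))\<^sup>2 + 2 * (norm (G x))\<^sup>2)"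
      using norm_diff_square_le by (intro AE_I2) (simp add: E_def G_def)
  qed measurable
  have int_f: "integrable ?L (\<lambda>x. f x \<bullet> cgrad \<Phi> x)"
    by (intro integrable_inner_of_squares f_L int_P) measurable
  have int_A: "integrable ?L (\<lambda>x. coeff_apply A x (Du x) \<bullet> cgrad \<Phi> x)"
  proof (rule Bochner_Integration.integrable_bound)
    show "integrable ?L (\<lambda>x. ((norm (Du x))\<^sup>2 + (norm (cgrad \<Phi> x))\<^sup>2) / \<mu>)"
      using Du_L(2) int_P by simp
    show "(\<lambda>x. coeff_apply A x (Du x) \<bullet> cgrad \<Phi> x) \<in> borel_measurable ?L"
      unfolding coeff_apply_inner by measurable
    show "AE x in ?L. norm (coeff_apply A x (Du x) \<bullet> cgrad \<Phi> x) \<le> norm (((norm (Du x))\<^sup>2 + (norm (cgrad \<Phi> x))\<^sup>2) / \<mu>)"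
      using A'
    proof eventually_elim
      case (elim x)
      have "\<bar>coeff_apply A x (Du x) \<bullet> cgrad \<Phi> x\<bar> \<le> norm (coeff_apply A x (Du x)) * norm (cgrad \<Phi> x)"
        by (rule Cauchy_Schwarz_ineq2)
      also have "\<dots> \<le> norm (Du x) / \<mu> * norm (cgrad \<Phi> x)"
        using elim by (intro mult_right_mono) auto
      also have "\<dots> = norm (Du x) * norm (cgrad \<Phi> x) / \<mu>" by simp
      also have "\<dots> \<le> ((norm (Du x))\<^sup>2 + (norm (cgrad \<Phi> x))\<^sup>2) / \<mu>"
        using \<mu> by (intro divide_right_mono mult_le_sum_squares) simp_all
      finally show ?case using \<mu> by simp
    qed
  qed

  let ?X = "LINT x|?L. (w x)\<^sup>2 * (norm (G x))\<^sup>2" and ?F = "LINT x|?L. (w x)\<^sup>2 * (norm (f x))\<^sup>2"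
    and ?E = "LINT x|?L. (w x)\<^sup>2 * (norm (E x))\<^sup>2" and ?H = "LINT x|?L. (norm (H x))\<^sup>2"
  let ?b = "\<lambda>x. coeff_apply A x (Du x) \<bullet> cgrad \<Phi> x + f x \<bullet> cgrad \<Phi> x"
  let ?c = "\<mu> / 4 + 2 / \<mu> ^ 3"
  let ?R = "\<lambda>x. ?b x + ?c * (norm (H x))\<^sup>2 + 4 / \<mu> * ((w x)\<^sup>2 * (norm (f x))\<^sup>2)
    + 4 / \<mu> ^ 3 * ((w x)\<^sup>2 * (norm (E x))\<^sup>2)"
  \<comment> \<open>Here the equation enters, tested with \<open>\<Phi>\<close>, that is
    \<open>w\<^sup>2 \<phi>\<close>.\<close>
  have b0: "(LINT x|?L. ?b x) = 0"
    using weak_solution_inner[OF \<Omega>(3) weak v\<Phi>] int_A int_f by simp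
  have "(LINT x|?L. 5 * \<mu> / 8 * ((w x)\<^sup>2 * (norm (G x))\<^sup>2)) \<le> (LINT x|?L. ?R x)"
  proof (rule integral_mono_AE)
    show "integrable ?L (\<lambda>x. 5 * \<mu> / 8 * ((w x)\<^sup>2 * (norm (G x))\<^sup>2))"
      by (intro integrable_mult_right int_w int_G)
    show "integrable ?L ?R"
      by (intro Bochner_Integration.integrable_add integrable_mult_right int_A int_f int_H int_w f_L int_E)
    show "AE x in ?L. 5 * \<mu> / 8 * ((w x)\<^sup>2 * (norm (G x))\<^sup>2) \<le> ?R x"
      using A'
    proof eventually_elim
      case (elim x)
      have eq: "coeff_apply A x (Du x) = coeff_apply A x (G x) + coeff_apply A x (E x)"
        unfolding coeff_apply_add[symmetric] by (simp add: E_def G_def)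
      from elim have "\<mu> * (norm (G x))\<^sup>2 \<le> coeff_apply A x (G x) \<bullet> G x"
        "norm (coeff_apply A x (G x)) \<le> norm (G x) / \<mu>" "norm (coeff_apply A x (E x)) \<le> norm (E x) / \<mu>"
        by blast+
      from energy_pointwise[OF \<mu> w(2) this] show ?case unfolding P eq .
    qed
  qed
  also have "(LINT x|?L. ?R x) = (LINT x|?L. ?b x) + ?c * ?H + 4 / \<mu> * ?F + 4 / \<mu> ^ 3 * ?E"
    using int_A int_f int_H int_w[OF f_L(2)] int_w[OF int_E]
    by simp
  finally have est: "5 * \<mu> / 8 * ?X \<le> ?c * ?H + 4 / \<mu> * ?F + 4 / \<mu> ^ 3 * ?E"
    unfolding b0 by simp
  have X0: "0 \<le> ?X" by (intro integral_nonneg_AE AE_I2) simp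
  have "?H \<le> 16 * s\<^sup>2 * hardy_const M N * ?X"
    unfolding G_def H_def
    by (rule weight_gradient_absorb[OF char M \<phi> w(1) _ s(1)]) (use gw w(2) in simp)
  then have "?c * ?H \<le> ?c * (16 * s\<^sup>2 * hardy_const M N * ?X)"
    using \<mu> by (intro mult_left_mono) auto
  also have "\<dots> = (?c * (16 * s\<^sup>2 * hardy_const M N)) * ?X" by simp
  also have "\<dots> \<le> \<mu> / 8 * ?X" by (intro mult_right_mono s(2) X0)
  finally have "\<mu> / 2 * ?X \<le> 4 / \<mu> * ?F + 4 / \<mu> ^ 3 * ?E" using est by simp
  \<comment> \<open>Absorbing \<open>\<mu> / 8\<close> from \<open>5 * \<mu> / 8\<close> leaves
    \<open>\<mu> / 2\<close>. The multiplier \<open>4 / \<mu>\<close> turns it into the factor 2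
    that reappears when \<open>|Du|^2\<close> is bounded by twice the squares of \<open>G\<close>
    and \<open>E\<close>.\<close>
  then have "4 / \<mu> * (\<mu> / 2 * ?X) \<le> 4 / \<mu> * (4 / \<mu> * ?F + 4 / \<mu> ^ 3 * ?E)"
    using \<mu> by (intro mult_left_mono) auto
  moreover have "4 / \<mu> * (\<mu> / 2 * ?X) = 2 * ?X" using \<mu> by simp
  moreover have "4 / \<mu> * (4 / \<mu> * ?F + 4 / \<mu> ^ 3 * ?E) = 16 / \<mu>\<^sup>2 * ?F + 16 / \<mu> ^ 4 * ?E"
    by (simp add: distrib_left power2_eq_square power3_eq_cube power4_eq_xxxx mult.assoc)
  ultimately have X: "2 * ?X \<le> 16 / \<mu>\<^sup>2 * ?F + 16 / \<mu> ^ 4 * ?E" by (simp only:)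
  have "(LINT x|?L. (w x)\<^sup>2 * (norm (Du x))\<^sup>2)
      \<le> (LINT x|?L. 2 * ((w x)\<^sup>2 * (norm (G x))\<^sup>2) + 2 * ((w x)\<^sup>2 * (norm (E x))\<^sup>2))"
  proof (rule integral_mono)
    show "integrable ?L (\<lambda>x. 2 * ((w x)\<^sup>2 * (norm (G x))\<^sup>2) + 2 * ((w x)\<^sup>2 * (norm (E x))\<^sup>2))"
      using int_w[OF int_G] int_w[OF int_E] by simp
    fix x
    have "(w x)\<^sup>2 * (norm (Du x))\<^sup>2 \<le> (w x)\<^sup>2 * (2 * (norm (G x))\<^sup>2 + 2 * (norm (E x))\<^sup>2)"
      using norm_add_square_le[of "G x" "E x"] by (intro mult_left_mono) (simp_all add: E_def G_def)
    then show "(w x)\<^sup>2 * (norm (Du x))\<^sup>2 \<le> 2 * ((w x)\<^sup>2 * (norm (G x))\<^sup>2) + 2 * ((w x)\<^sup>2 * (norm (E x))\<^sup>2)"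
      by (simp add: algebra_simps)
  qed (intro int_w Du_L)
  also have "\<dots> = 2 * ?X + 2 * ?E" using int_w[OF int_G] int_w[OF int_E] by simp
  finally show ?thesis using X unfolding E_def by (simp add: distrib_right)
qed

section \<open>Limits in the approximation of \<open>u\<close> and in the weight\<close>

lemma weighted_energy:
  fixes \<Omega> :: "(real^'d::finite) set" and u :: "real^'d \<Rightarrow> real^'m::finite"
  assumes char: "lipschitz_domain_char \<Omega> M N" and M: "0 \<le> M"
    and \<mu>: "0 < \<mu>" and A: "elliptic \<mu> A" and u: "H10 \<Omega> u Du" and f: "L2 \<Omega> f"
    and weak: "weak_solution \<Omega> A Du f"
    and w: "smooth w" "\<And>x. 0 \<le> w x"
    and gw: "\<And>x. x \<in> \<Omega> \<Longrightarrow> norm (gradient w x) * infdist x (frontier \<Omega>) \<le> s * w x"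
    and s: "4 * hardy_const M N * s\<^sup>2 \<le> 1" "(\<mu> / 4 + 2 / \<mu> ^ 3) * (16 * s\<^sup>2 * hardy_const M N) \<le> \<mu> / 8"
  shows "(LINT x|lebesgue_on \<Omega>. (w x)\<^sup>2 * (norm (Du x))\<^sup>2)
    \<le> 16 / \<mu>\<^sup>2 * (LINT x|lebesgue_on \<Omega>. (w x)\<^sup>2 * (norm (f x))\<^sup>2)"
proof -
  let ?L = "lebesgue_on \<Omega>"
  have \<Omega>: "open \<Omega>" "bounded \<Omega>" "\<Omega> \<in> sets lebesgue"
    using char by (auto simp: lipschitz_domain_char_def sets_completionI_sets)
  from u have uL2: "L2 \<Omega> u" and Du: "L2 \<Omega> Du" by (auto simp: H10_def H1_def)
  note uL = L2_lebesgue_on[OF \<Omega>(3) uL2] and Du_L = L2_lebesgue_on[OF \<Omega>(3) Du]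
  from u obtain \<phi> where \<phi>: "\<And>k. vtest_fn \<Omega> (\<phi> k)"
    and lim: "(\<lambda>k. LINT x:\<Omega>|lebesgue. (norm (u x - \<phi> k x))\<^sup>2 + (norm (Du x - cgrad (\<phi> k) x))\<^sup>2) \<longlonglongrightarrow> 0"
    unfolding H10_def by blast
  have w2: "continuous_on UNIV (\<lambda>x. (w x)\<^sup>2)" by (intro continuous_intros smooth_continuous w)
  obtain B where B: "0 \<le> B" "\<And>x. x \<in> \<Omega> \<Longrightarrow> norm ((w x)\<^sup>2) \<le> B"
    using continuous_bounded_on_bounded[OF w2 \<Omega>(2)] by blast
  let ?E = "\<lambda>k. LINT x|?L. (w x)\<^sup>2 * (norm (Du x - cgrad (\<phi> k) x))\<^sup>2"
  let ?d = "\<lambda>k. LINT x|?L. (norm (u x - \<phi> k x))\<^sup>2 + (norm (Du x - cgrad (\<phi> k) x))\<^sup>2"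
  have E_le: "?E k \<le> B * ?d k" for k
  proof -
    have c: "continuous_on UNIV (cgrad (\<phi> k))" by (rule continuous_on_cgrad[OF \<phi>])
    have "continuous_on UNIV (\<lambda>x. \<chi> \<alpha>. \<phi> k x $ \<alpha>)"
      by (intro continuous_on_vec_lambda smooth_continuous test_fn_smooth[of \<Omega>])
        (use \<phi>[of k] in \<open>simp add: vtest_fn_def\<close>)
    then have c': "continuous_on UNIV (\<phi> k)" by simp
    \<comment> \<open>The integral of a non-integrable function is 0 by default, so the convergence
      to 0 says something about the gradients only once both squares are known to be
      integrable.\<close>
    have sq: "integrable ?L (\<lambda>x. (norm (g x - h x))\<^sup>2)"
      if "g \<in> borel_measurable ?L" "integrable ?L (\<lambda>x. (norm (g x))\<^sup>2)" "continuous_on UNIV h"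
      for g h :: "real^'d \<Rightarrow> 'b::euclidean_space"
    proof (rule Bochner_Integration.integrable_bound)
      have "integrable ?L (\<lambda>x. (norm (h x))\<^sup>2)"
        by (intro integrable_continuous_lebesgue_on[OF _ \<Omega>(2,3)] continuous_intros that)
      then show "integrable ?L (\<lambda>x. 2 * (norm (g x))\<^sup>2 + 2 * (norm (h x))\<^sup>2)" using that by simp
      show "(\<lambda>x. (norm (g x - h x))\<^sup>2) \<in> borel_measurable ?L"
        using that(1) continuous_measurable_lebesgue_on[OF that(3), of \<Omega>] by measurable
      show "AE x in ?L. norm ((norm (g x - h x))\<^sup>2) \<le> norm (2 * (norm (g x))\<^sup>2 + 2 * (norm (h x))\<^sup>2)"
        using norm_diff_square_le by (intro AE_I2) simp
    qed
    note i1 = sq[OF uL c'] and i2 = sq[OF Du_L c]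
    have "?E k \<le> (LINT x|?L. B * ((norm (u x - \<phi> k x))\<^sup>2 + (norm (Du x - cgrad (\<phi> k) x))\<^sup>2))"
    proof (rule integral_mono)
      show "integrable ?L (\<lambda>x. (w x)\<^sup>2 * (norm (Du x - cgrad (\<phi> k) x))\<^sup>2)"
        by (rule integrable_mult_continuous[OF w2 \<Omega>(2) i2])
      show "integrable ?L (\<lambda>x. B * ((norm (u x - \<phi> k x))\<^sup>2 + (norm (Du x - cgrad (\<phi> k) x))\<^sup>2))"
        using i1 i2 by simp
      fix x assume "x \<in> space ?L"
      then have "(w x)\<^sup>2 \<le> B" using B(2)[of x] by simp
      then show "(w x)\<^sup>2 * (norm (Du x - cgrad (\<phi> k) x))\<^sup>2
          \<le> B * ((norm (u x - \<phi> k x))\<^sup>2 + (norm (Du x - cgrad (\<phi> k) x))\<^sup>2)"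
        using B(1) by (intro mult_mono) auto
    qed
    then show ?thesis by simp
  qed
  have Bd: "(\<lambda>k. B * ?d k) \<longlonglongrightarrow> 0"
    using tendsto_mult_right_zero[OF lim[unfolded set_integral_lebesgue_on[OF \<Omega>(3)]], of B] .
  have E_nonneg: "0 \<le> ?E k" for k by (intro integral_nonneg_AE AE_I2) simp
  have E0: "?E \<longlonglongrightarrow> 0"
    by (rule tendsto_sandwich[OF always_eventually always_eventually tendsto_const Bd])
      (simp_all only: E_le E_nonneg simp_thms)
  have "(\<lambda>k. 16 / \<mu>\<^sup>2 * (LINT x|?L. (w x)\<^sup>2 * (norm (f x))\<^sup>2) + (16 / \<mu> ^ 4 + 2) * ?E k)
      \<longlonglongrightarrow> 16 / \<mu>\<^sup>2 * (LINT x|?L. (w x)\<^sup>2 * (norm (f x))\<^sup>2) + (16 / \<mu> ^ 4 + 2) * 0"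
    by (intro tendsto_intros E0)
  then have "(LINT x|?L. (w x)\<^sup>2 * (norm (Du x))\<^sup>2)
      \<le> 16 / \<mu>\<^sup>2 * (LINT x|?L. (w x)\<^sup>2 * (norm (f x))\<^sup>2) + (16 / \<mu> ^ 4 + 2) * 0"
    by (rule LIMSEQ_le_const) (intro exI[of _ 0] allI impI weighted_energy_test[OF char M \<mu> A Du f weak \<phi> w gw s])
  then show ?thesis by simp
qed

text \<open>With \<open>w = \<eta> powr (\<sigma> / 2)\<close> the derivative loses one power of
  \<open>\<eta>\<close>, which the distance restores since it is below \<open>\<eta>\<close>. So
  \<open>s\<close> is \<open>\<bar>\<sigma>\<bar> / 2\<close>, and the smallness constants 4 and 16
  become 1 and 4.\<close>

lemma weighted_energy_nn_integral:
  fixes \<Omega> :: "(real^'d::finite) set" and u :: "real^'d \<Rightarrow> real^'m::finite"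
  assumes char: "lipschitz_domain_char \<Omega> M N" and M: "0 \<le> M"
    and \<mu>: "0 < \<mu>" and A: "elliptic \<mu> A" and u: "H10 \<Omega> u Du" and f: "L2 \<Omega> f"
    and weak: "weak_solution \<Omega> A Du f"
    and \<eta>: "smooth \<eta>" "\<And>x. infdist x (frontier \<Omega>) < \<eta> x" "\<And>x. norm (gradient \<eta> x) \<le> 1"
    and s: "hardy_const M N * \<sigma>\<^sup>2 \<le> 1" "(\<mu> / 4 + 2 / \<mu> ^ 3) * (4 * \<sigma>\<^sup>2 * hardy_const M N) \<le> \<mu> / 8"
  shows "(\<integral>\<^sup>+x. ennreal ((norm (Du x))\<^sup>2 * \<eta> x powr \<sigma>) \<partial>lebesgue_on \<Omega>)
    \<le> ennreal (16 / \<mu>\<^sup>2) * (\<integral>\<^sup>+x. ennreal ((norm (f x))\<^sup>2 * \<eta> x powr \<sigma>) \<partial>lebesgue_on \<Omega>)"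
proof -
  let ?L = "lebesgue_on \<Omega>"
  have \<Omega>: "bounded \<Omega>" "\<Omega> \<in> sets lebesgue"
    using char by (auto simp: lipschitz_domain_char_def sets_completionI_sets)
  have Du: "L2 \<Omega> Du" using u by (simp add: H10_def H1_def)
  have \<eta>_pos: "0 < \<eta> x" for x using \<eta>(2)[of x] infdist_nonneg[of x "frontier \<Omega>"] by linarith
  define w where "w x = \<eta> x powr (\<sigma> / 2)" for x
  have w: "smooth w" unfolding w_def[abs_def] by (rule smooth_powr[OF \<eta>(1) \<eta>_pos])
  have w2: "(w x)\<^sup>2 = \<eta> x powr \<sigma>" for x
    by (simp add: w_def power2_eq_square powr_add[symmetric])
  have gw: "norm (gradient w x) * infdist x (frontier \<Omega>) \<le> \<bar>\<sigma>\<bar> / 2 * w x" for x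
  proof -
    have "((\<lambda>t. t powr (\<sigma> / 2)) has_real_derivative \<sigma> / 2 * \<eta> x powr (\<sigma> / 2 - 1)) (at (\<eta> x))"
      using \<eta>_pos by (rule has_real_derivative_powr)
    from partial_compose[OF this smooth_differentiable[OF \<eta>(1)]]
    have "gradient w x = (\<sigma> / 2 * \<eta> x powr (\<sigma> / 2 - 1)) *\<^sub>R gradient \<eta> x"
      by (simp add: gradient_def vec_eq_iff w_def[abs_def])
    then have "norm (gradient w x) * infdist x (frontier \<Omega>)
        = \<bar>\<sigma>\<bar> / 2 * \<eta> x powr (\<sigma> / 2 - 1) * (norm (gradient \<eta> x) * infdist x (frontier \<Omega>))"
      by (simp add: abs_mult)
    also have "\<dots> \<le> \<bar>\<sigma>\<bar> / 2 * \<eta> x powr (\<sigma> / 2 - 1) * (1 * \<eta> x)"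
      using \<eta>(2)[of x] \<eta>(3)[of x] by (intro mult_left_mono mult_mono) (auto intro: infdist_nonneg less_imp_le)
    also have "\<dots> = \<bar>\<sigma>\<bar> / 2 * w x"
      using \<eta>_pos[of x] by (simp add: w_def powr_diff)
    finally show ?thesis .
  qed
  have "4 * hardy_const M N * (\<bar>\<sigma>\<bar> / 2)\<^sup>2 \<le> 1"
    and "(\<mu> / 4 + 2 / \<mu> ^ 3) * (16 * (\<bar>\<sigma>\<bar> / 2)\<^sup>2 * hardy_const M N) \<le> \<mu> / 8"
    using s by (simp_all add: power_divide)
  from weighted_energy[OF char M \<mu> A u f weak w _ gw this]
  have est: "(LINT x|?L. (norm (Du x))\<^sup>2 * \<eta> x powr \<sigma>) \<le> 16 / \<mu>\<^sup>2 * (LINT x|?L. (norm (f x))\<^sup>2 * \<eta> x powr \<sigma>)"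
    unfolding w2 by (simp add: w_def mult.commute)
  have cont: "continuous_on UNIV (\<lambda>x. \<eta> x powr \<sigma>)"
    by (rule smooth_continuous[OF smooth_powr[OF \<eta>(1) \<eta>_pos]])
  have nn: "(\<integral>\<^sup>+x. ennreal ((norm (g x))\<^sup>2 * \<eta> x powr \<sigma>) \<partial>?L) = ennreal (LINT x|?L. (norm (g x))\<^sup>2 * \<eta> x powr \<sigma>)"
    if "L2 \<Omega> g" for g :: "real^'d \<Rightarrow> real^'d^'m"
    using integrable_mult_continuous[OF cont \<Omega>(1) L2_lebesgue_on(2)[OF \<Omega>(2) that]]
    by (intro nn_integral_eq_integral) (simp_all add: mult.commute)
  have "0 \<le> (LINT x|?L. (norm (f x))\<^sup>2 * \<eta> x powr \<sigma>)" by (intro integral_nonneg_AE AE_I2) simp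
  then show ?thesis
    unfolding nn[OF Du] nn[OF f] using est by (subst ennreal_mult[symmetric]) (auto intro: ennreal_leI)
qed

text \<open>Since the majorants lie above the distance, one side of the estimate compares directly
  and the other needs a limit theorem. For nonnegative \<open>\<sigma>\<close> the left side is
  monotone and the right side converges by dominated convergence; for negative
  \<open>\<sigma>\<close> the right side is monotone and Fatou's lemma handles the left, even if the
  right side is infinite.\<close>

lemma weighted_energy_infdist:
  fixes \<Omega> :: "(real^'d::finite) set" and u :: "real^'d \<Rightarrow> real^'m::finite"
  assumes char: "lipschitz_domain_char \<Omega> M N" and M: "0 \<le> M"
    and \<mu>: "0 < \<mu>" and A: "elliptic \<mu> A" and u: "H10 \<Omega> u Du" and f: "L2 \<Omega> f"
    and weak: "weak_solution \<Omega> A Du f"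
    and s: "hardy_const M N * \<sigma>\<^sup>2 \<le> 1" "(\<mu> / 4 + 2 / \<mu> ^ 3) * (4 * \<sigma>\<^sup>2 * hardy_const M N) \<le> \<mu> / 8"
  shows "(\<integral>\<^sup>+x. ennreal ((norm (Du x))\<^sup>2 * infdist x (frontier \<Omega>) powr \<sigma>) \<partial>lebesgue_on \<Omega>)
    \<le> ennreal (16 / \<mu>\<^sup>2) * (\<integral>\<^sup>+x. ennreal ((norm (f x))\<^sup>2 * infdist x (frontier \<Omega>) powr \<sigma>) \<partial>lebesgue_on \<Omega>)"
proof -
  let ?L = "lebesgue_on \<Omega>"
  define \<rho> where "\<rho> x = infdist x (frontier \<Omega>)" for x
  have \<Omega>: "open \<Omega>" "bounded \<Omega>" "\<Omega> \<noteq> {}" "\<Omega> \<in> sets lebesgue"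
    using char by (auto simp: lipschitz_domain_char_def sets_completionI_sets)
  have Du: "L2 \<Omega> Du" using u by (simp add: H10_def H1_def)
  have fr: "compact (frontier \<Omega>)" "frontier \<Omega> \<noteq> {}"
    using \<Omega> infdist_frontier_pos(2)[OF \<Omega>(1,2)] by (auto simp: compact_frontier_bounded)
  have \<rho>_pos: "0 < \<rho> x" if "x \<in> \<Omega>" for x
    unfolding \<rho>_def by (rule infdist_frontier_pos[OF \<Omega>(1,2) that])
  have "\<exists>\<eta>. smooth \<eta> \<and> (\<forall>x. \<rho> x < \<eta> x) \<and> (\<forall>x. \<eta> x \<le> \<rho> x + inverse (real (Suc n))) \<and> (\<forall>x. norm (gradient \<eta> x) \<le> 1)" for n
  proof -
    \<comment> \<open>The divisor 3 offsets the error \<open>3 * e\<close> of the smooth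
      approximation.\<close>
    have "0 < inverse (real (Suc n)) / 3" by simp
    from smooth_infdist_approx[OF fr this] show ?thesis
      unfolding \<rho>_def by (metis nonzero_mult_div_cancel_left times_divide_eq_right zero_neq_numeral)
  qed
  then obtain \<eta> where \<eta>: "\<And>n. smooth (\<eta> n)" "\<And>n x. \<rho> x < \<eta> n x"
    "\<And>n x. \<eta> n x \<le> \<rho> x + inverse (real (Suc n))" "\<And>n x. norm (gradient (\<eta> n) x) \<le> 1"
    by metis
  have \<rho>_nonneg: "0 \<le> \<rho> x" for x by (simp add: \<rho>_def infdist_nonneg)
  have \<eta>_pos: "0 < \<eta> n x" for n x using \<eta>(2)[of x n] \<rho>_nonneg[of x] by linarith
  note est = weighted_energy_nn_integral[OF char M \<mu> A u f weak \<eta>(1) \<eta>(2)[unfolded \<rho>_def] \<eta>(4) s]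
  have \<eta>_lim: "(\<lambda>n. \<eta> n x) \<longlonglongrightarrow> \<rho> x" for x
  proof (rule tendsto_sandwich[OF _ _ tendsto_const])
    show "(\<lambda>n. \<rho> x + inverse (real (Suc n))) \<longlonglongrightarrow> \<rho> x"
      using tendsto_add[OF tendsto_const LIMSEQ_inverse_real_of_nat, of "\<rho> x"] by simp
  qed (use \<eta>(2,3) in \<open>auto intro!: always_eventually less_imp_le simp del: of_nat_Suc\<close>)
  have lim: "(\<lambda>n. ennreal ((norm (g x))\<^sup>2 * \<eta> n x powr \<sigma>)) \<longlonglongrightarrow> ennreal ((norm (g x))\<^sup>2 * \<rho> x powr \<sigma>)"
    if "x \<in> \<Omega>" for x and g :: "real^'d \<Rightarrow> real^'d^'m"
    using \<rho>_pos[OF that] by (intro tendsto_ennrealI tendsto_intros \<eta>_lim) auto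
  have [measurable]: "Du \<in> borel_measurable ?L" "f \<in> borel_measurable ?L"
    using L2_lebesgue_on(1)[OF \<Omega>(4)] Du f by auto
  have [measurable]: "\<eta> n \<in> borel_measurable ?L" "\<rho> \<in> borel_measurable ?L" for n
    unfolding \<rho>_def
    by (intro continuous_measurable_lebesgue_on smooth_continuous \<eta> continuous_intros)+
  let ?U = "\<lambda>n. \<integral>\<^sup>+x. ennreal ((norm (Du x))\<^sup>2 * \<eta> n x powr \<sigma>) \<partial>?L"
  let ?F = "\<lambda>n. \<integral>\<^sup>+x. ennreal ((norm (f x))\<^sup>2 * \<eta> n x powr \<sigma>) \<partial>?L"
  let ?V = "\<integral>\<^sup>+x. ennreal ((norm (Du x))\<^sup>2 * \<rho> x powr \<sigma>) \<partial>?L"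
  let ?G = "\<integral>\<^sup>+x. ennreal ((norm (f x))\<^sup>2 * \<rho> x powr \<sigma>) \<partial>?L"
  have "?V \<le> ennreal (16 / \<mu>\<^sup>2) * ?G"
  proof (cases "0 \<le> \<sigma>")
    case True
    have "?V \<le> ?U n" for n
      using True \<eta>(2) \<rho>_nonneg
      by (intro nn_integral_mono ennreal_leI mult_left_mono powr_mono2) (auto intro: less_imp_le)
    then have le: "?V \<le> ennreal (16 / \<mu>\<^sup>2) * ?F n" for n using est order_trans by blast
    have "continuous_on UNIV \<rho>" unfolding \<rho>_def by (intro continuous_intros)
    then obtain B where B: "0 \<le> B" "\<And>x. x \<in> \<Omega> \<Longrightarrow> norm (\<rho> x) \<le> B"
      using continuous_bounded_on_bounded[OF _ \<Omega>(2)] by blast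
    \<comment> \<open>On the domain \<open>\<eta> n\<close> is at most \<open>B + 1\<close>, because
      it exceeds the distance by at most 1; the nonnegative exponent turns this into a dominating
      function.\<close>
    have "?F \<longlonglongrightarrow> ?G"
    proof (rule nn_integral_dominated_convergence[where w = "\<lambda>x. ennreal ((norm (f x))\<^sup>2 * (B + 1) powr \<sigma>)"])
      have "integrable ?L (\<lambda>x. (norm (f x))\<^sup>2 * (B + 1) powr \<sigma>)"
        using L2_lebesgue_on(2)[OF \<Omega>(4) f] by simp
      from nn_integral_eq_integral[OF this]
      show "(\<integral>\<^sup>+x. ennreal ((norm (f x))\<^sup>2 * (B + 1) powr \<sigma>) \<partial>?L) < \<infinity>" by simp
      show "AE x in ?L. ennreal ((norm (f x))\<^sup>2 * \<eta> n x powr \<sigma>) \<le> ennreal ((norm (f x))\<^sup>2 * (B + 1) powr \<sigma>)" for n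
      proof (intro AE_I2 ennreal_leI mult_left_mono powr_mono2 True)
        fix x assume "x \<in> space ?L"
        then have "\<rho> x \<le> B" using B(2)[of x] by simp
        moreover have "inverse (real (Suc n)) \<le> 1" by (simp add: inverse_le_1_iff)
        ultimately show "\<eta> n x \<le> B + 1" using \<eta>(3)[of n x] by linarith
        show "0 \<le> \<eta> n x" using \<eta>_pos[of n x] by simp
      qed simp
      show "AE x in ?L. (\<lambda>n. ennreal ((norm (f x))\<^sup>2 * \<eta> n x powr \<sigma>)) \<longlonglongrightarrow> ennreal ((norm (f x))\<^sup>2 * \<rho> x powr \<sigma>)"
        using lim by (intro AE_I2) simp
    qed measurable
    then have "(\<lambda>n. ennreal (16 / \<mu>\<^sup>2) * ?F n) \<longlonglongrightarrow> ennreal (16 / \<mu>\<^sup>2) * ?G"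
      by (intro ennreal_tendsto_cmult) simp_all
    then show ?thesis by (rule LIMSEQ_le_const) (use le in blast)
  next
    case False
    have "?F n \<le> ?G" for n
    proof (intro nn_integral_mono ennreal_leI mult_left_mono)
      fix x assume "x \<in> space ?L"
      then show "\<eta> n x powr \<sigma> \<le> \<rho> x powr \<sigma>"
        using \<rho>_pos[of x] \<eta>(2)[of x n] False by (intro powr_mono2') auto
    qed simp
    then have le: "?U n \<le> ennreal (16 / \<mu>\<^sup>2) * ?G" for n
      using est[of n] mult_left_mono[of "?F n" "?G" "ennreal (16 / \<mu>\<^sup>2)"] by (meson order_trans zero_le)
    \<comment> \<open>The distance is positive inside the domain, so the weights converge there even
      for a negative exponent, and Fatou's lemma applies.\<close>
    have "?V = (\<integral>\<^sup>+x. liminf (\<lambda>n. ennreal ((norm (Du x))\<^sup>2 * \<eta> n x powr \<sigma>)) \<partial>?L)"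
      by (intro nn_integral_cong lim_imp_Liminf[symmetric, OF sequentially_bot lim]) simp
    also have "\<dots> \<le> liminf ?U" by (rule nn_integral_liminf) measurable
    also have "\<dots> \<le> limsup ?U" by (rule Liminf_le_Limsup) simp
    also have "\<dots> \<le> ennreal (16 / \<mu>\<^sup>2) * ?G" by (rule Limsup_bounded) (use le in simp)
    finally show ?thesis .
  qed
  then show ?thesis unfolding \<rho>_def .
qed

theorem theorem7p2:
  "\<forall>\<mu>>0. \<forall>M\<ge>0. \<forall>N::nat. \<exists>\<kappa>. 0 < \<kappa> \<and> \<kappa> < 1/2 \<and> (\<exists>C>0.
     \<forall>(\<Omega> :: (real^'d::finite) set) (A :: real^'d \<Rightarrow> 'm::finite \<Rightarrow> 'm \<Rightarrow> 'd \<Rightarrow> 'd \<Rightarrow> real)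
       (u :: real^'d \<Rightarrow> real^'m) (Du :: real^'d \<Rightarrow> real^'d^'m) (f :: real^'d \<Rightarrow> real^'d^'m) (\<sigma>::real).
       lipschitz_domain_char \<Omega> M N \<longrightarrow> elliptic \<mu> A \<longrightarrow> H10 \<Omega> u Du \<longrightarrow> L2 \<Omega> f \<longrightarrow>
       weak_solution \<Omega> A Du f \<longrightarrow> \<bar>\<sigma>\<bar> \<le> 2 * \<kappa> \<longrightarrow>
       (\<integral>\<^sup>+x\<in>\<Omega>. ennreal ((norm (Du x))\<^sup>2 * infdist x (frontier \<Omega>) powr \<sigma>) \<partial>lebesgue)
         \<le> ennreal C * (\<integral>\<^sup>+x\<in>\<Omega>. ennreal ((norm (f x))\<^sup>2 * infdist x (frontier \<Omega>) powr \<sigma>) \<partial>lebesgue))"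
proof (intro allI impI)
  fix \<mu> M :: real and N :: nat
  assume \<mu>: "0 < \<mu>" and M: "0 \<le> M"
  define H c where "H = hardy_const M N" and "c = \<mu> / 4 + 2 / \<mu> ^ 3"
  have H: "0 < H" unfolding H_def hardy_const_def by (simp add: add_pos_nonneg)
  have c: "0 < c" using \<mu> by (simp add: c_def add_pos_pos)
  \<comment> \<open>The two smallness conditions of the energy estimate solved for
    \<open>\<sigma>\<^sup>2\<close>.\<close>
  define q where "q = min (1 / H) (\<mu> / (32 * c * H))"
  have q: "0 < q" using H c \<mu> by (simp add: q_def)
  \<comment> \<open>\<open>2 * \<kappa> \<le> sqrt q\<close> gives
    \<open>\<sigma>\<^sup>2 \<le> q\<close>, and the cap 1/4 keeps \<open>\<kappa>\<close> below
    1/2. Only \<open>\<mu>\<close>, \<open>M\<close> and \<open>N\<close> enter, and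
    \<open>C\<close> below depends on \<open>\<mu>\<close> alone.\<close>
  define \<kappa> where "\<kappa> = min (1 / 4) (sqrt q / 2)"
  have "\<kappa> \<le> 1 / 4" unfolding \<kappa>_def by (rule min.cobounded1)
  then have \<kappa>: "0 < \<kappa>" "\<kappa> < 1 / 2" using q by (simp_all add: \<kappa>_def)
  have small: "H * \<sigma>\<^sup>2 \<le> 1" "c * (4 * \<sigma>\<^sup>2 * H) \<le> \<mu> / 8" if "\<bar>\<sigma>\<bar> \<le> 2 * \<kappa>" for \<sigma>
  proof -
    have "\<bar>\<sigma>\<bar> \<le> sqrt q" using that by (simp add: \<kappa>_def)
    then have "\<sigma>\<^sup>2 \<le> q" using q real_sqrt_le_iff[of "\<sigma>\<^sup>2" q] by simp
    then have "\<sigma>\<^sup>2 \<le> 1 / H" "\<sigma>\<^sup>2 \<le> \<mu> / (32 * c * H)" by (simp_all add: q_def)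
    then show "H * \<sigma>\<^sup>2 \<le> 1" "c * (4 * \<sigma>\<^sup>2 * H) \<le> \<mu> / 8"
      using H c by (simp_all add: field_simps)
  qed
  show "\<exists>\<kappa>. 0 < \<kappa> \<and> \<kappa> < 1/2 \<and> (\<exists>C>0.
     \<forall>(\<Omega> :: (real^'d) set) (A :: real^'d \<Rightarrow> 'm \<Rightarrow> 'm \<Rightarrow> 'd \<Rightarrow> 'd \<Rightarrow> real)
       (u :: real^'d \<Rightarrow> real^'m) (Du :: real^'d \<Rightarrow> real^'d^'m) (f :: real^'d \<Rightarrow> real^'d^'m) (\<sigma>::real).
       lipschitz_domain_char \<Omega> M N \<longrightarrow> elliptic \<mu> A \<longrightarrow> H10 \<Omega> u Du \<longrightarrow> L2 \<Omega> f \<longrightarrow>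
       weak_solution \<Omega> A Du f \<longrightarrow> \<bar>\<sigma>\<bar> \<le> 2 * \<kappa> \<longrightarrow>
       (\<integral>\<^sup>+x\<in>\<Omega>. ennreal ((norm (Du x))\<^sup>2 * infdist x (frontier \<Omega>) powr \<sigma>) \<partial>lebesgue)
         \<le> ennreal C * (\<integral>\<^sup>+x\<in>\<Omega>. ennreal ((norm (f x))\<^sup>2 * infdist x (frontier \<Omega>) powr \<sigma>) \<partial>lebesgue))"
  proof (rule exI[of _ \<kappa>], intro conjI \<kappa>, rule exI[of _ "16 / \<mu>\<^sup>2"], intro conjI allI impI)
    show "0 < 16 / \<mu>\<^sup>2" using \<mu> by simp
    fix \<Omega> :: "(real^'d) set" and A :: "real^'d \<Rightarrow> 'm \<Rightarrow> 'm \<Rightarrow> 'd \<Rightarrow> 'd \<Rightarrow> real"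
      and u :: "real^'d \<Rightarrow> real^'m" and Du f :: "real^'d \<Rightarrow> real^'d^'m" and \<sigma> :: real
    assume *: "lipschitz_domain_char \<Omega> M N" "elliptic \<mu> A" "H10 \<Omega> u Du" "L2 \<Omega> f" "weak_solution \<Omega> A Du f"
      and \<sigma>: "\<bar>\<sigma>\<bar> \<le> 2 * \<kappa>"
    have "\<Omega> \<in> sets lebesgue" using *(1) by (auto simp: lipschitz_domain_char_def sets_completionI_sets)
    then have restr: "(\<integral>\<^sup>+x\<in>\<Omega>. h x \<partial>lebesgue) = (\<integral>\<^sup>+x. h x \<partial>lebesgue_on \<Omega>)" for h
      by (simp add: nn_integral_restrict_space)
    show "(\<integral>\<^sup>+x\<in>\<Omega>. ennreal ((norm (Du x))\<^sup>2 * infdist x (frontier \<Omega>) powr \<sigma>) \<partial>lebesgue)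
         \<le> ennreal (16 / \<mu>\<^sup>2) * (\<integral>\<^sup>+x\<in>\<Omega>. ennreal ((norm (f x))\<^sup>2 * infdist x (frontier \<Omega>) powr \<sigma>) \<partial>lebesgue)"
      unfolding restr
      by (rule weighted_energy_infdist[OF *(1) M \<mu> *(2-5) small[OF \<sigma>, unfolded H_def c_def]])
  qed
qed

end
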